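(* Assume Martin's Axiom (MA). Let $(X,\mu)$ be a standard non-atomic Borel probability space and $G$ a group. Then every measure preserving near-action of $G$ on $(X,\mu)$ has a spatial model.
   Context: A measure preserving near-action of $G$ is a map $\eta:G\times X\to X$, writing $\eta(g)(x)=\eta(g,x)$, such that: (1) $\eta(e)(x)=x$ for almost all $x$; (2) for all $g,h\in G$, $\eta(gh)(x)=\eta(g)(\eta(h)(x))$ for almost all $x$; (3) for every Borel $B\subseteq X$ and $g\in G$, $\eta(g)(B)$ is $\mu$-measurable and $\mu(\eta(g)(B))=\mu(B)$. A spatial model of $\eta$ is an action $\rho:G\times X\to X$ of $G$ on $X$ in the usual sense which is measure preserving (for every Borel $B$ and $g\in G$, $\rho(g)(B)$ is $\mu$-measurable and $\mu(\rho(g)(B))=\mu(B)$) and such that for each $g\in G$, $\eta(g,x)=\rho(g,x)$ for $\mu$-a.e. $x$. *)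

theory Defs
  imports
    "HOL-Probability.Probability"
    "HOL-Algebra.Group_Action"
    "HOL-Library.Equipollence"
begin

section \<open>Martin's Axiom\<close>

text \<open>
  A forcing poset is a carrier \<open>P\<close> with a partial order \<open>r\<close>, where \<open>(p, q) \<in> r\<close> means that
  \<open>p\<close> is below (is stronger than) \<open>q\<close>.
\<close>

definition compatible :: "'p set \<Rightarrow> 'p rel \<Rightarrow> 'p \<Rightarrow> 'p \<Rightarrow> bool" where
  "compatible P r p q \<longleftrightarrow> (\<exists>s\<in>P. (s, p) \<in> r \<and> (s, q) \<in> r)"

definition ccc_poset :: "'p set \<Rightarrow> 'p rel \<Rightarrow> bool" where
  "ccc_poset P r \<longleftrightarrow> partial_order_on P r \<and>
     (\<forall>A\<subseteq>P. (\<forall>p\<in>A. \<forall>q\<in>A. p \<noteq> q \<longrightarrow> \<not> compatible P r p q) \<longrightarrow> countable A)"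

definition dense_in_poset :: "'p set \<Rightarrow> 'p rel \<Rightarrow> 'p set \<Rightarrow> bool" where
  "dense_in_poset P r D \<longleftrightarrow> D \<subseteq> P \<and> (\<forall>p\<in>P. \<exists>d\<in>D. (d, p) \<in> r)"

definition poset_filter :: "'p set \<Rightarrow> 'p rel \<Rightarrow> 'p set \<Rightarrow> bool" where
  "poset_filter P r F \<longleftrightarrow> F \<subseteq> P \<and> F \<noteq> {} \<and>
     (\<forall>p\<in>F. \<forall>q\<in>F. \<exists>s\<in>F. (s, p) \<in> r \<and> (s, q) \<in> r) \<and>
     (\<forall>p\<in>F. \<forall>q\<in>P. (p, q) \<in> r \<longrightarrow> q \<in> F)"

text \<open>
  A HOL formula cannot quantify over all types, so the axiom is stated for the posets carried by
  subsets of a given type. The lemma \<open>martins_axiom_any_type\<close> below shows that the instance for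
  the type of real numbers implies the instance for every type, so that \<open>martins_axiom TYPE(real)\<close>
  is Martin's Axiom for arbitrary ccc posets.
\<close>

definition martins_axiom :: "'p itself \<Rightarrow> bool" where
  "martins_axiom _ \<longleftrightarrow>
     (\<forall>(P :: 'p set) r \<D>. P \<noteq> {} \<and> ccc_poset P r \<and> (\<forall>D\<in>\<D>. dense_in_poset P r D) \<and>
        \<D> \<prec> (UNIV :: real set) \<longrightarrow>
        (\<exists>F. poset_filter P r F \<and> (\<forall>D\<in>\<D>. F \<inter> D \<noteq> {})))"

lemma small_closure:
  fixes p :: 'p and f :: "'p \<Rightarrow> 'p \<Rightarrow> 'p" and g :: "'i \<Rightarrow> 'p \<Rightarrow> 'p"
  assumes "I \<prec> (UNIV :: real set)"
  obtains Q where "p \<in> Q" "\<And>x y. x \<in> Q \<Longrightarrow> y \<in> Q \<Longrightarrow> f x y \<in> Q"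
    "\<And>i x. i \<in> I \<Longrightarrow> x \<in> Q \<Longrightarrow> g i x \<in> Q" "Q \<lesssim> (UNIV :: real set)"
proof -
  define S where "S = rec_nat {p} (\<lambda>_ A. A \<union> (\<lambda>(x, y). f x y) ` (A \<times> A) \<union> (\<lambda>(i, x). g i x) ` (I \<times> A))"
  have S0: "S 0 = {p}"
    and SS: "S (Suc n) = S n \<union> (\<lambda>(x, y). f x y) ` (S n \<times> S n) \<union> (\<lambda>(i, x). g i x) ` (I \<times> S n)" for n
    by (simp_all add: S_def)
  let ?R = "card_of (UNIV :: real set)"
  have inf: "\<not> finite (UNIV :: real set)"
    by (simp add: infinite_UNIV_char_0)
  have co: "\<not> finite (Field ?R)" "Card_order ?R"
    using inf card_of_Card_order by (simp_all only: Field_card_of not_False_eq_True)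
  have I: "ordLeq3 (card_of I) ?R"
    using assms by (meson card_of_ordLeq lepoll_def lesspoll_def)
  have n: "ordLeq3 (card_of (S n)) ?R" for n
  proof (induction n)
    case 0
    show ?case
      unfolding S0 by (simp add: card_of_singl_ordLeq)
  next
    case (Suc n)
    have "ordLeq3 (card_of (S n \<times> S n)) ?R" "ordLeq3 (card_of (I \<times> S n)) ?R"
      using Suc I co by (simp_all add: card_of_Times_ordLeq_infinite_Field)
    then show ?case
      unfolding SS
      by (intro card_of_Un_ordLeq_infinite_Field co Suc)
         (auto intro: ordLeq_transitive[OF card_of_image])
  qed
  have mono: "S m \<subseteq> S n" if "m \<le> n" for m n
    using that by (rule lift_Suc_mono_le[rotated]) (auto simp: SS)
  define Q where "Q = (\<Union>n. S n)"
  show ?thesis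
  proof (rule that[of Q])
    show "p \<in> Q"
      using S0 by (auto simp: Q_def)
    show "f x y \<in> Q" if "x \<in> Q" "y \<in> Q" for x y
    proof -
      from that obtain m k where "x \<in> S m" "y \<in> S k"
        by (auto simp: Q_def)
      then have "x \<in> S (max m k)" "y \<in> S (max m k)"
        using mono by (meson max.cobounded1 max.cobounded2 subsetD)+
      then have "f x y \<in> S (Suc (max m k))"
        by (auto simp: SS)
      then show ?thesis
        by (auto simp: Q_def)
    qed
    show "g i x \<in> Q" if "i \<in> I" "x \<in> Q" for i x
    proof -
      from that obtain m where "x \<in> S m"
        by (auto simp: Q_def)
      then have "g i x \<in> S (Suc m)"
        using that by (auto simp: SS)
      then show ?thesis
        by (auto simp: Q_def)
    qed
    have "ordLeq3 (card_of (UNIV :: nat set)) ?R"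
      using inf infinite_iff_card_of_nat by blast
    then have "ordLeq3 (card_of Q) ?R"
      unfolding Q_def using n by (intro card_of_UNION_ordLeq_infinite inf) auto
    then show "Q \<lesssim> (UNIV :: real set)"
      by (meson card_of_ordLeq lepoll_def)
  qed
qed

lemma martins_axiom_any_type:
  assumes "martins_axiom TYPE(real)"
  shows "martins_axiom TYPE('p)"
  unfolding martins_axiom_def
proof (intro allI impI, elim conjE)
  fix P :: "'p set" and r \<D>
  assume ne: "P \<noteq> {}" and ccc: "ccc_poset P r" and dense: "\<forall>D\<in>\<D>. dense_in_poset P r D"
    and small: "\<D> \<prec> (UNIV :: real set)"
  have po: "r \<subseteq> P \<times> P" "refl_on P r" "trans r" "antisym r"
    using ccc by (auto simp: ccc_poset_def partial_order_on_def preorder_on_def)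
  obtain p0 where p0: "p0 \<in> P"
    using ne by blast
  define low where "low p q = (if compatible P r p q then SOME s. s \<in> P \<and> (s, p) \<in> r \<and> (s, q) \<in> r else p0)" for p q
  define sel where "sel D p = (if p \<in> P then SOME d. d \<in> D \<and> (d, p) \<in> r else p0)" for D p
  have low: "low p q \<in> P \<and> (low p q, p) \<in> r \<and> (low p q, q) \<in> r" if "compatible P r p q" for p q
    using that someI_ex[of "\<lambda>s. s \<in> P \<and> (s, p) \<in> r \<and> (s, q) \<in> r"]
    by (auto simp: low_def compatible_def)
  have sel: "sel D p \<in> D \<and> (sel D p, p) \<in> r" if "D \<in> \<D>" "p \<in> P" for D p
  proof -
    have "\<exists>d. d \<in> D \<and> (d, p) \<in> r"
      using dense that unfolding dense_in_poset_def by blast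
    from someI_ex[OF this] show ?thesis
      using that by (simp add: sel_def)
  qed
  obtain Q0 where Q0: "p0 \<in> Q0" "\<And>x y. x \<in> Q0 \<Longrightarrow> y \<in> Q0 \<Longrightarrow> low x y \<in> Q0"
    "\<And>D x. D \<in> \<D> \<Longrightarrow> x \<in> Q0 \<Longrightarrow> sel D x \<in> Q0" "Q0 \<lesssim> (UNIV :: real set)"
    using small_closure[OF small, of p0 low sel] by blast
  define Q where "Q = Q0 \<inter> P"
  have QP: "Q \<subseteq> P"
    by (auto simp: Q_def)
  have Qlow: "low x y \<in> Q" if "x \<in> Q" "y \<in> Q" "compatible P r x y" for x y
    using that Q0(2) low by (auto simp: Q_def)
  have Qsel: "sel D x \<in> Q" if "D \<in> \<D>" "x \<in> Q" for D x
    using that Q0(3) sel po by (fastforce simp: Q_def)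
  have "Q \<lesssim> (UNIV :: real set)"
    unfolding Q_def by (rule lepoll_trans[OF subset_imp_lepoll Q0(4)]) simp
  then obtain f :: "'p \<Rightarrow> real" where f: "inj_on f Q"
    by (auto simp: lepoll_def)
  define r' where "r' = {(f x, f y) |x y. x \<in> Q \<and> y \<in> Q \<and> (x, y) \<in> r}"
  define \<D>' where "\<D>' = (\<lambda>D. f ` (D \<inter> Q)) ` \<D>"
  have r': "(f x, f y) \<in> r' \<longleftrightarrow> (x, y) \<in> r" if "x \<in> Q" "y \<in> Q" for x y
    using that f by (auto simp: r'_def inj_on_def)
  have r'_sub: "r' \<subseteq> f ` Q \<times> f ` Q"
    by (auto simp: r'_def)
  have "refl_on (f ` Q) r'"
    using po(2) QP by (auto simp: refl_on_def r')
  moreover have "trans r'"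
  proof (rule transI)
    fix a b c assume "(a, b) \<in> r'" "(b, c) \<in> r'"
    moreover from this obtain x y z where "a = f x" "b = f y" "c = f z" "x \<in> Q" "y \<in> Q" "z \<in> Q"
      using r'_sub by blast
    ultimately show "(a, c) \<in> r'"
      using po(3) by (auto simp: r' dest: transD)
  qed
  moreover have "antisym r'"
  proof (rule antisymI)
    fix a b assume "(a, b) \<in> r'" "(b, a) \<in> r'"
    moreover from this obtain x y where "a = f x" "b = f y" "x \<in> Q" "y \<in> Q"
      using r'_sub by blast
    ultimately show "a = b"
      using po(4) by (auto simp: r' dest: antisymD)
  qed
  ultimately have po': "partial_order_on (f ` Q) r'"
    using r'_sub by (auto simp: partial_order_on_def preorder_on_def)
  have compat: "compatible (f ` Q) r' (f x) (f y)" if "x \<in> Q" "y \<in> Q" "compatible P r x y" for x y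
    using Qlow[OF that] low[OF that(3)] that by (auto simp: compatible_def r')
  have ccc': "ccc_poset (f ` Q) r'"
    unfolding ccc_poset_def
  proof (intro conjI allI impI po')
    fix A assume A: "A \<subseteq> f ` Q" "\<forall>p\<in>A. \<forall>q\<in>A. p \<noteq> q \<longrightarrow> \<not> compatible (f ` Q) r' p q"
    define B where "B = {x \<in> Q. f x \<in> A}"
    have "\<forall>p\<in>B. \<forall>q\<in>B. p \<noteq> q \<longrightarrow> \<not> compatible P r p q"
    proof (intro ballI impI notI)
      fix p q assume *: "p \<in> B" "q \<in> B" "p \<noteq> q" "compatible P r p q"
      then have "f p \<noteq> f q"
        using f by (auto simp: B_def inj_on_def)
      then show False
        using * A(2) compat by (auto simp: B_def)
    qed
    moreover have "B \<subseteq> P"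
      using QP by (auto simp: B_def)
    ultimately have "countable B"
      using ccc by (auto simp: ccc_poset_def)
    moreover have "A = f ` B"
      using A(1) by (auto simp: B_def)
    ultimately show "countable A"
      by simp
  qed
  have dense': "\<forall>D\<in>\<D>'. dense_in_poset (f ` Q) r' D"
  proof
    fix D' assume "D' \<in> \<D>'"
    then obtain D where D: "D \<in> \<D>" "D' = f ` (D \<inter> Q)"
      by (auto simp: \<D>'_def)
    have "\<exists>d\<in>D'. (d, f x) \<in> r'" if "x \<in> Q" for x
      using Qsel[OF D(1) that] sel[OF D(1)] that QP D(2)
      by (intro bexI[of _ "f (sel D x)"]) (auto simp: r')
    then show "dense_in_poset (f ` Q) r' D'"
      using D(2) by (auto simp: dense_in_poset_def)
  qed
  have "\<D>' \<prec> (UNIV :: real set)"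
    unfolding \<D>'_def using small image_lepoll lesspoll_trans1 by blast
  moreover have "f ` Q \<noteq> {}"
    using Q0(1) p0 by (auto simp: Q_def)
  ultimately obtain F' where F': "poset_filter (f ` Q) r' F'" "\<forall>D\<in>\<D>'. F' \<inter> D \<noteq> {}"
    using assms ccc' dense' unfolding martins_axiom_def by meson
  define F where "F = {p \<in> P. \<exists>q\<in>Q. f q \<in> F' \<and> (q, p) \<in> r}"
  have F'Q: "F' \<subseteq> f ` Q"
    using F'(1) by (auto simp: poset_filter_def)
  have QF: "q \<in> F" if "q \<in> Q" "f q \<in> F'" for q
    using that QP po(2) by (auto simp: F_def refl_on_def)
  have "poset_filter P r F"
    unfolding poset_filter_def
  proof (intro conjI ballI impI)
    show "F \<subseteq> P"
      by (auto simp: F_def)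
    show "F \<noteq> {}"
      using F'(1) F'Q QF by (fastforce simp: poset_filter_def)
    show "\<exists>s\<in>F. (s, p) \<in> r \<and> (s, q) \<in> r" if pq: "p \<in> F" "q \<in> F" for p q
    proof -
      obtain x y where xy: "x \<in> Q" "f x \<in> F'" "(x, p) \<in> r" "y \<in> Q" "f y \<in> F'" "(y, q) \<in> r"
        using pq by (auto simp: F_def)
      then obtain s' where "s' \<in> F'" "(s', f x) \<in> r'" "(s', f y) \<in> r'"
        using F'(1) unfolding poset_filter_def by blast
      moreover from this obtain s where "s' = f s" "s \<in> Q"
        using F'Q by blast
      ultimately show ?thesis
        using xy QF[of s] po(3) by (auto simp: r' intro!: bexI[of _ s] dest: transD)
    qed
    show "q \<in> F" if "p \<in> F" "q \<in> P" "(p, q) \<in> r" for p q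
      using that po(3) unfolding F_def by (blast dest: transD)
  qed
  moreover have "\<forall>D\<in>\<D>. F \<inter> D \<noteq> {}"
  proof
    fix D assume "D \<in> \<D>"
    then have "F' \<inter> f ` (D \<inter> Q) \<noteq> {}"
      using F'(2) by (auto simp: \<D>'_def)
    then show "F \<inter> D \<noteq> {}"
      using QF by blast
  qed
  ultimately show "\<exists>F. poset_filter P r F \<and> (\<forall>D\<in>\<D>. F \<inter> D \<noteq> {})"
    by blast
qed

section \<open>Standard non-atomic Borel probability spaces\<close>

definition polish_topology :: "'x topology \<Rightarrow> bool" where
  "polish_topology T \<longleftrightarrow> completely_metrizable_space T \<and> separable_space T"

definition standard_borel :: "'x measure \<Rightarrow> bool" where
  "standard_borel M \<longleftrightarrow>
     (\<exists>T. polish_topology T \<and> topspace T = space M \<and>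
          sets M = sigma_sets (space M) {U. openin T U})"

definition non_atomic :: "'x measure \<Rightarrow> bool" where
  "non_atomic M \<longleftrightarrow>
     (\<forall>A\<in>sets M. emeasure M A > 0 \<longrightarrow>
        (\<exists>B\<in>sets M. B \<subseteq> A \<and> 0 < emeasure M B \<and> emeasure M B < emeasure M A))"

section \<open>Near-actions and spatial models\<close>

text \<open>
  The \<open>\<mu>\<close>-measurable sets are the measurable sets of the completion of \<open>\<mu>\<close>. The condition is about
  forward images of Borel sets; no measurability of the map itself is required.
\<close>

definition image_measure_preserving :: "'x measure \<Rightarrow> ('x \<Rightarrow> 'x) \<Rightarrow> bool" where
  "image_measure_preserving M f \<longleftrightarrow>
     (\<forall>B\<in>sets M. f ` B \<in> sets (completion M) \<and> emeasure (completion M) (f ` B) = emeasure M B)"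

definition measure_preserving_near_action ::
  "('g, 'b) monoid_scheme \<Rightarrow> 'x measure \<Rightarrow> ('g \<Rightarrow> 'x \<Rightarrow> 'x) \<Rightarrow> bool" where
  "measure_preserving_near_action G M \<eta> \<longleftrightarrow>
     (\<forall>g\<in>carrier G. \<eta> g \<in> space M \<rightarrow> space M) \<and>
     (AE x in M. \<eta> \<one>\<^bsub>G\<^esub> x = x) \<and>
     (\<forall>g\<in>carrier G. \<forall>h\<in>carrier G. AE x in M. \<eta> (g \<otimes>\<^bsub>G\<^esub> h) x = \<eta> g (\<eta> h x)) \<and>
     (\<forall>g\<in>carrier G. image_measure_preserving M (\<eta> g))"

definition spatial_model ::
  "('g, 'b) monoid_scheme \<Rightarrow> 'x measure \<Rightarrow> ('g \<Rightarrow> 'x \<Rightarrow> 'x) \<Rightarrow> ('g \<Rightarrow> 'x \<Rightarrow> 'x) \<Rightarrow> bool" where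
  "spatial_model G M \<eta> \<rho> \<longleftrightarrow>
     group_action G (space M) \<rho> \<and>
     (\<forall>g\<in>carrier G. image_measure_preserving M (\<rho> g)) \<and>
     (\<forall>g\<in>carrier G. AE x in M. \<eta> g x = \<rho> g x)"

end

theory Submission
  imports Defs "HOL-Algebra.Generated_Groups"
begin

text \<open>
  Dividing out the elements that act trivially almost everywhere, one may assume that \<open>G\<close> has at most
  continuum many elements, because a near-automorphism is determined up to null sets by countably many
  open sets. Write \<open>G\<close> as the union of a chain of subgroups \<open>H\<close> of size below the continuum. Under MA
  a union of fewer than continuum many null sets is null, so each \<open>H\<close> acts genuinely at almost every
  point; moreover the \<open>H\<close>-orbit of such a point may be required to avoid a fixed null set \<open>N\<close> of size
  continuum. For a point \<open>x\<close> let \<open>A\<close> be the union of the members of the chain acting genuinely at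
  \<open>x\<close>. The \<open>A\<close>-orbit of \<open>x\<close> sits inside the induced \<open>G\<close>-set, and the remaining points of all the
  induced \<open>G\<close>-sets together can be chosen in \<open>N\<close>, since nothing is prescribed there. This
  defines an action of \<open>G\<close> which agrees with the near-action of each \<open>g \<in> H\<close> wherever \<open>H\<close> acts genuinely.
\<close>

section \<open>Probability measures on Polish spaces\<close>

lemma separable_metrizable_imp_second_countable:
  assumes "metrizable_space X" "separable_space X"
  shows "second_countable X"
proof -
  obtain M d where "Metric_space M d" and X: "X = Metric_space.mtopology M d"
    using assms(1) metrizable_space_def by blast
  then interpret Metric_space M d by simp
  obtain C where C: "countable C" "C \<subseteq> M" "mtopology closure_of C = M"
    using assms(2) by (auto simp: separable_space_def X)
  define \<B> where "\<B> = (\<lambda>(c, n::nat). mball c (inverse (Suc n))) ` (C \<times> UNIV)"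
  have "\<exists>V\<in>\<B>. x \<in> V \<and> V \<subseteq> U" if U: "openin mtopology U" "x \<in> U" for U x
  proof -
    obtain r where r: "r > 0" "mball x r \<subseteq> U"
      using U openin_mtopology by blast
    obtain n :: nat where n: "inverse (Suc n) < r / 2"
      using reals_Archimedean[of "r / 2"] r by auto
    have xM: "x \<in> M"
      using U openin_mtopology by blast
    then have "x \<in> mtopology closure_of C"
      using C by simp
    then have "\<exists>c\<in>C. c \<in> mball x (inverse (Suc n))"
      unfolding metric_closure_of by (simp del: in_mball)
    then obtain c where c: "c \<in> C" "c \<in> mball x (inverse (Suc n))"
      by blast
    have "mball c (inverse (Suc n)) \<subseteq> mball x r"
    proof
      fix y assume y: "y \<in> mball c (inverse (Suc n))"
      then have "d x y \<le> d x c + d c y"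
        using c xM by (intro triangle) auto
      then show "y \<in> mball x r"
        using y c xM n by auto
    qed
    moreover have "x \<in> mball c (inverse (Suc n))"
      using c xM by (auto simp: commute)
    ultimately show ?thesis
      using r c unfolding \<B>_def by (intro bexI[of _ "mball c (inverse (Suc n))"]) auto
  qed
  moreover have "countable \<B>"
    using C by (auto simp: \<B>_def)
  moreover have "\<forall>V\<in>\<B>. openin mtopology V"
    by (auto simp: \<B>_def)
  ultimately show ?thesis
    unfolding second_countable_def X by blast
qed

lemma Pow_countable_lepoll_real:
  assumes "countable A"
  shows "Pow A \<lesssim> (UNIV :: real set)"
proof -
  have "inj_on ((`) (to_nat_on A)) (Pow A)"
    using inj_on_to_nat_on[OF assms] by (intro inj_on_image) simp
  then have "Pow A \<lesssim> (UNIV :: nat set set)"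
    by (auto simp: lepoll_def)
  then show ?thesis
    using nat_sets_eqpoll_reals lepoll_trans eqpoll_imp_lepoll by blast
qed

text \<open>Continuity from below along an enumeration of \<open>S\<close>. It serves twice: to
  attach a finite code to each amoeba condition, and to bound the measure of the union of a
  filter.\<close>

lemma (in prob_space) finite_subfamily_approx:
  assumes "countable S" "S \<subseteq> events" "0 < d"
  obtains F where "finite F" "F \<subseteq> S" "prob (\<Union>S) - d < prob (\<Union>F)"
proof (cases "S = {}")
  case True
  then show ?thesis
    using assms that[of "{}"] by simp
next
  case False
  define A where "A n = (\<Union>i<n. from_nat_into S i)" for n
  have A: "A n \<in> events" for n
    using assms(2) False by (auto simp: A_def intro!: sets.finite_UN from_nat_into)
  have "incseq A"
    unfolding A_def by (intro incseq_SucI UN_mono) auto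
  then have "(\<lambda>n. prob (A n)) \<longlonglongrightarrow> prob (\<Union>n. A n)"
    using A by (intro finite_Lim_measure_incseq) auto
  also have "(\<Union>n. A n) = (\<Union>i. from_nat_into S i)"
    by (auto simp: A_def)
  also have "\<dots> = \<Union>S"
    using range_from_nat_into[OF False assms(1)] by simp
  finally have "\<forall>\<^sub>F n in sequentially. prob (\<Union>S) - d < prob (A n)"
    using assms(3) by (intro order_tendstoD) auto
  then obtain n where "prob (\<Union>S) - d < prob (A n)"
    using eventually_sequentially by auto
  then show ?thesis
    using that[of "from_nat_into S ` {..<n}"] from_nat_into[OF False]
    by (simp add: A_def image_subset_iff)
qed

text \<open>\<open>standard_borel\<close> merely asserts that a topology exists. Here one such
  topology and a countable base of it are fixed, so that covering and counting arguments can refer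
  to them.\<close>

locale polish_prob_space = prob_space M for M :: "'x measure" +
  fixes T :: "'x topology" and \<B> :: "'x set set"
  assumes complete: "completely_metrizable_space T"
    and topspace [simp]: "topspace T = space M"
    and sets_eq: "sets M = sigma_sets (space M) {U. openin T U}"
    and base: "countable \<B>" "\<And>B. B \<in> \<B> \<Longrightarrow> openin T B"
      "\<And>U x. openin T U \<Longrightarrow> x \<in> U \<Longrightarrow> \<exists>B\<in>\<B>. x \<in> B \<and> B \<subseteq> U"
begin

section \<open>Borel sets and regularity of the measure\<close>

lemma metrizable: "metrizable_space T"
  using complete by (rule completely_metrizable_imp_metrizable_space)

lemma open_event: "openin T U \<Longrightarrow> U \<in> events"
  by (auto simp: sets_eq)

lemma open_eq_Union_base: "openin T U \<Longrightarrow> U = \<Union>{B\<in>\<B>. B \<subseteq> U}"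
  using base(3) by blast

lemma point_event: "x \<in> space M \<Longrightarrow> {x} \<in> events"
proof -
  assume x: "x \<in> space M"
  have "closedin T {x}"
    using metrizable_imp_t1_space[OF metrizable] x by (simp add: t1_space_closedin_singleton)
  then have "openin T (space M - {x})"
    by (auto simp: closedin_def)
  then have "space M - (space M - {x}) \<in> events"
    using open_event by blast
  with x show ?thesis
    by (simp add: double_diff)
qed

text \<open>Regularity is proved for a set together with its complement, so that the property is
  visibly closed under complements.\<close>

lemma open_cover_pair:
  assumes "B \<in> events" "0 < e"
  shows "\<exists>U V. openin T U \<and> openin T V \<and> B \<subseteq> U \<and> space M - B \<subseteq> V \<and> prob (U \<inter> V) < e"
proof -
  from assms(1) have "B \<in> sigma_sets (space M) {U. openin T U}"
    by (simp add: sets_eq)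
  then show ?thesis
    using assms(2)
  proof (induction arbitrary: e)
    case (Basic U)
    then have U: "openin T U" by simp
    then have "closedin T (space M - U)"
      by (metis closedin_def double_diff openin_subset topspace Diff_subset order_refl)
    \<comment> \<open>In a metrizable space the closed complement of \<open>U\<close> is a
      descending intersection of open sets \<open>C n\<close>, so the overlaps
      \<open>U \<inter> C n\<close> shrink to the empty set.\<close>
    then have "gdelta_in T (space M - U)"
      using metrizable closed_imp_gdelta_in by blast
    then obtain C where C: "\<And>n. openin T (C n)" "\<And>n. C (Suc n) \<subseteq> C n" "\<Inter>(range C) = space M - U"
      unfolding gdelta_in_descending by blast
    have "decseq (\<lambda>n. U \<inter> C n)"
      using C(2) by (intro decseq_SucI) auto
    then have "(\<lambda>n. prob (U \<inter> C n)) \<longlonglongrightarrow> prob (\<Inter>n. U \<inter> C n)"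
      using U C(1) by (intro finite_Lim_measure_decseq) (auto intro: open_event)
    also have "(\<Inter>n. U \<inter> C n) = {}"
      using C(3) by auto
    finally have "\<forall>\<^sub>F n in sequentially. prob (U \<inter> C n) < e"
      using Basic by (intro order_tendstoD) auto
    then obtain n where "prob (U \<inter> C n) < e"
      using eventually_sequentially by auto
    moreover have "space M - U \<subseteq> C n"
      unfolding C(3)[symmetric] by blast
    ultimately show ?case
      using U C(1) by (intro exI[of _ U] exI[of _ "C n"]) simp
  next
    case Empty
    then show ?case
      by (intro exI[of _ "{}"] exI[of _ "space M"]) (use openin_topspace[of T] in auto)
  next
    case (Compl a)
    from Compl.IH[OF Compl.prems] obtain U V where
      "openin T U" "openin T V" "a \<subseteq> U" "space M - a \<subseteq> V" "prob (U \<inter> V) < e"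
      by blast
    then show ?case
      by (intro exI[of _ V] exI[of _ U]) (auto simp: Int_commute)
  next
    case (Union a)
    \<comment> \<open>The errors of the single sets add up to \<open>e / 2\<close>; the other half
      of \<open>e\<close> is reserved for the remainder \<open>R n\<close>.\<close>
    have "\<exists>U V. openin T U \<and> openin T V \<and> a i \<subseteq> U \<and> space M - a i \<subseteq> V \<and>
      prob (U \<inter> V) < e / 2 * (1 / 2) ^ Suc i" for i
      by (rule Union.IH) (use Union.prems in simp)
    then obtain U V where UV: "\<And>i. openin T (U i)" "\<And>i. openin T (V i)" "\<And>i. a i \<subseteq> U i"
      "\<And>i. space M - a i \<subseteq> V i" "\<And>i. prob (U i \<inter> V i) < e / 2 * (1 / 2) ^ Suc i"
      by metis
    have a: "a i \<in> events" for i
      using Union.hyps by (simp add: sets_eq)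
    define R where "R n = (\<Union>i. a i) - (\<Union>i<n. a i)" for n
    have R: "R n \<in> events" for n
      using a by (auto simp: R_def)
    have "decseq R"
      by (intro decseq_SucI) (auto simp: R_def)
    then have "(\<lambda>n. prob (R n)) \<longlonglongrightarrow> prob (\<Inter>n. R n)"
      using R by (intro finite_Lim_measure_decseq) auto
    also have "(\<Inter>n. R n) = {}"
      by (auto simp: R_def)
    finally have "\<forall>\<^sub>F n in sequentially. prob (R n) < e / 2"
      using Union.prems by (intro order_tendstoD) auto
    then obtain n where n: "prob (R n) < e / 2"
      using eventually_sequentially by auto
    \<comment> \<open>Only finitely many of the open sets \<open>V i\<close> are intersected, so
      that \<open>V'\<close> stays open. The part of the union not reached by \<open>a 0\<close>,
      ..., \<open>a (n - 1)\<close> is \<open>R n\<close>, which is small.\<close>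
    define U' V' where "U' = (\<Union>i. U i)" and "V' = space M \<inter> (\<Inter>i<n. V i)"
    have U': "openin T U'"
      unfolding U'_def using UV by auto
    have V': "openin T V'"
    proof (cases n)
      case 0
      then show ?thesis
        using openin_topspace[of T] by (simp add: V'_def)
    next
      case (Suc m)
      then show ?thesis
        unfolding V'_def using UV openin_topspace[of T]
        by (intro openin_Int openin_INT2) auto
    qed
    have W: "U i \<inter> V i \<in> events" for i
      using UV by (auto intro: open_event)
    have sums: "(\<lambda>i. e / 2 * (1 / 2) ^ Suc i) sums (e / 2)"
      using sums_mult[OF power_half_series, of "e / 2"] by simp
    have summable: "summable (\<lambda>i. prob (U i \<inter> V i))"
      by (rule summable_comparison_test'[of _ 0, OF sums_summable[OF sums]])
         (use UV(5) less_imp_le in auto)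
    have "U' \<inter> V' \<subseteq> R n \<union> (\<Union>i. U i \<inter> V i)"
    proof
      fix p assume p: "p \<in> U' \<inter> V'"
      then obtain i where i: "p \<in> U i"
        by (auto simp: U'_def)
      consider "p \<notin> (\<Union>i. a i)" | j where "j < n" "p \<in> a j" | "p \<in> R n"
        by (auto simp: R_def)
      then show "p \<in> R n \<union> (\<Union>i. U i \<inter> V i)"
      proof cases
        case 1
        then have "p \<in> V i"
          using UV(4)[of i] p by (auto simp: V'_def)
        with i show ?thesis by auto
      next
        case 2
        then show ?thesis
          using UV(3)[of j] p by (auto simp: V'_def)
      qed auto
    qed
    then have "prob (U' \<inter> V') \<le> prob (R n \<union> (\<Union>i. U i \<inter> V i))"
      using R W by (intro finite_measure_mono) auto
    also have "\<dots> \<le> prob (R n) + prob (\<Union>i. U i \<inter> V i)"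
      using R W by (intro measure_Un_le) auto
    also have "prob (\<Union>i. U i \<inter> V i) \<le> (\<Sum>i. prob (U i \<inter> V i))"
      using W summable by (intro finite_measure_subadditive_countably) auto
    also have "\<dots> \<le> (\<Sum>i. e / 2 * (1 / 2) ^ Suc i)"
      using UV(5) less_imp_le by (intro suminf_le summable sums_summable[OF sums]) blast
    also have "\<dots> = e / 2"
      using sums by (rule sums_unique[symmetric])
    finally have "prob (U' \<inter> V') < e"
      using n by simp
    moreover have "(\<Union>i. a i) \<subseteq> U'"
      using UV(3) by (auto simp: U'_def)
    moreover have "space M - (\<Union>i. a i) \<subseteq> V'"
      using UV(4) by (auto simp: V'_def)
    ultimately show ?case
      using U' V' by blast
  qed
qed

lemma outer_regular:
  assumes B: "B \<in> events" and "0 < e"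
  obtains U where "openin T U" "B \<subseteq> U" "prob U < prob B + e"
proof -
  obtain U V where UV: "openin T U" "openin T V" "B \<subseteq> U" "space M - B \<subseteq> V" "prob (U \<inter> V) < e"
    using open_cover_pair[OF assms] by blast
  have "U \<subseteq> B \<union> (U \<inter> V)"
    using UV openin_subset[OF UV(1)] by auto
  then have "prob U \<le> prob (B \<union> (U \<inter> V))"
    using UV B by (intro finite_measure_mono) (auto intro: open_event)
  also have "\<dots> \<le> prob B + prob (U \<inter> V)"
    using UV B by (intro measure_Un_le) (auto intro: open_event)
  finally show ?thesis
    using UV by (intro that[of U]) auto
qed

section \<open>Null sets, amoeba forcing and Martin's Axiom\<close>

lemma open_cover_null:
  assumes "N \<in> null_sets (completion M)" "0 < e"
  obtains U where "openin T U" "N \<subseteq> U" "prob U < e"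
proof -
  obtain N' where N': "N' \<in> null_sets M" "N \<subseteq> N'"
    using assms(1) by (auto simp: null_sets_completion_iff2)
  then show ?thesis
    using outer_regular[of N' e] assms(2) that by (force simp: measure_eq_0_null_sets)
qed

text \<open>Intersecting covers of measure at most \<open>1 / (n + 1)\<close> gives a Borel null set
  around \<open>N\<close>. The bound is weak because the union of a filter of conditions of measure
  below \<open>e\<close> may have measure exactly \<open>e\<close>.\<close>

lemma null_if_small_covers:
  assumes "\<And>e. 0 < e \<Longrightarrow> \<exists>U. openin T U \<and> N \<subseteq> U \<and> prob U \<le> e"
  shows "N \<in> null_sets (completion M)"
proof -
  have "\<exists>U. openin T U \<and> N \<subseteq> U \<and> prob U \<le> inverse (Suc n)" for n :: nat
    using assms by simp
  then obtain U where U: "\<And>n. openin T (U n)" "\<And>n. N \<subseteq> U n" "\<And>n::nat. prob (U n) \<le> inverse (Suc n)"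
    by metis
  have "(\<Inter>n. U n) \<in> events"
    using U by (auto intro: open_event)
  moreover have "prob (\<Inter>n. U n) \<le> 0 + e" if e: "0 < e" for e
  proof -
    obtain n where "inverse (Suc n) < e"
      using reals_Archimedean[OF e] by blast
    moreover have "prob (\<Inter>n. U n) \<le> prob (U n)"
      using U(1) by (intro finite_measure_mono) (auto intro: open_event)
    ultimately show ?thesis
      using U(3)[of n] by simp
  qed
  then have "prob (\<Inter>n. U n) \<le> 0"
    by (rule field_le_epsilon)
  then have "prob (\<Inter>n. U n) = 0"
    by (simp add: measure_le_0_iff)
  ultimately have "(\<Inter>n. U n) \<in> null_sets M"
    by (simp add: null_sets_def emeasure_eq_measure)
  then show ?thesis
    unfolding null_sets_completion_iff2 using U(2) by (intro bexI[of _ "\<Inter>n. U n"]) auto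
qed

text \<open>Amoeba forcing is ccc: two conditions are compatible as soon as the same finite union of basic
  open sets exhausts each of them up to half of its slack \<open>e - prob U\<close>.\<close>

lemma ccc_amoeba:
  fixes e :: real
  defines "P \<equiv> {U. openin T U \<and> prob U < e}"
  shows "ccc_poset P {(U, V). U \<in> P \<and> V \<in> P \<and> V \<subseteq> U}"
  unfolding ccc_poset_def
proof (intro conjI allI impI)
  let ?r = "{(U, V). U \<in> P \<and> V \<in> P \<and> V \<subseteq> U}"
  show "partial_order_on P ?r"
    by (auto simp: partial_order_on_def preorder_on_def refl_on_def trans_def antisym_def)
  fix A assume A: "A \<subseteq> P" "\<forall>p\<in>A. \<forall>q\<in>A. p \<noteq> q \<longrightarrow> \<not> compatible P ?r p q"
  have "\<exists>F. finite F \<and> F \<subseteq> \<B> \<and> \<Union>F \<subseteq> U \<and> prob U - prob (\<Union>F) < (e - prob U) / 2" if "U \<in> A" for U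
  proof -
    have U: "openin T U" "0 < (e - prob U) / 2"
      using that A by (auto simp: P_def)
    define S where "S = {B\<in>\<B>. B \<subseteq> U}"
    have S: "countable S" "S \<subseteq> events" "\<Union>S = U"
      using base(1,2) open_event open_eq_Union_base[OF U(1)] by (auto simp: S_def)
    obtain F where F: "finite F" "F \<subseteq> S" "prob (\<Union>S) - (e - prob U) / 2 < prob (\<Union>F)"
      by (rule finite_subfamily_approx[OF S(1,2) U(2)])
    moreover have "F \<subseteq> \<B>" "\<Union>F \<subseteq> U"
      using F(2) by (auto simp: S_def)
    ultimately show ?thesis
      unfolding S(3) by (intro exI[of _ F]) linarith
  qed
  then obtain c where c: "\<And>U. U \<in> A \<Longrightarrow> finite (c U) \<and> c U \<subseteq> \<B> \<and> \<Union>(c U) \<subseteq> U \<and>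
    prob U - prob (\<Union>(c U)) < (e - prob U) / 2"
    by metis
  have ev: "\<Union>(c U) \<in> events" if "U \<in> A" for U
    using c[OF that] base(2) open_event by (intro sets.finite_Union) auto
  have "inj_on c A"
  \<comment> \<open>A countable base has only countably many finite subsets, so an antichain on
    which \<open>c\<close> is injective is countable. Two conditions with the same code have a union
    of measure below \<open>e\<close>, which is a common extension.\<close>
  proof (rule inj_onI, rule ccontr)
    fix U V assume UV: "U \<in> A" "V \<in> A" "c U = c V" "U \<noteq> V"
    let ?C = "\<Union>(c U)"
    have open': "openin T U" "openin T V"
      using UV A by (auto simp: P_def)
    then have e: "U \<in> events" "V \<in> events" "?C \<in> events"
      using open_event ev UV by auto
    have sub: "?C \<subseteq> U" "?C \<subseteq> V"
      using c[OF UV(1)] c[OF UV(2)] UV(3) by auto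
    have diff: "prob (U - ?C) = prob U - prob ?C" "prob (V - ?C) = prob V - prob ?C"
      using e sub by (auto simp: finite_measure_Diff)
    have "prob (U \<union> V) = prob (?C \<union> ((U - ?C) \<union> (V - ?C)))"
      using sub by (intro arg_cong[of _ _ prob]) auto
    also have "\<dots> \<le> prob ?C + (prob (U - ?C) + prob (V - ?C))"
      using e by (intro order_trans[OF measure_Un_le] add_left_mono measure_Un_le) auto
    also have "\<dots> < e"
    proof -
      have "prob ?C \<le> prob U" "prob ?C \<le> prob V"
        using e sub by (auto intro: finite_measure_mono)
      then show ?thesis
        using c[OF UV(1)] c[OF UV(2)] UV(3) diff by (simp add: field_simps)
    qed
    finally have "U \<union> V \<in> P"
      using open' by (auto simp: P_def)
    then have "compatible P ?r U V"
      using UV A by (auto simp: compatible_def)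
    then show False
      using A UV by blast
  qed
  moreover have "countable (c ` A)"
    using c by (intro countable_subset[OF _ countable_Collect_finite_subset[OF base(1)]]) auto
  ultimately show "countable A"
    using countable_image_inj_on by blast
qed

text \<open>Stronger conditions are larger open sets, so directedness of the filter yields one
  condition containing two given ones; induction extends this to finitely many.\<close>

lemma filter_finite_subcover:
  assumes F: "poset_filter P {(U, V). U \<in> P \<and> V \<in> P \<and> V \<subseteq> U} F"
    and "finite S" "\<forall>B\<in>S. \<exists>U\<in>F. B \<subseteq> U"
  shows "\<exists>U\<in>F. \<Union>S \<subseteq> U"
  using assms(2,3)
proof (induction S rule: finite_induct)
  case empty
  then show ?case
    using F by (auto simp: poset_filter_def)
next
  case (insert B S)
  then obtain U V where UV: "U \<in> F" "\<Union>S \<subseteq> U" "V \<in> F" "B \<subseteq> V"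
    by auto
  from F have "\<forall>p\<in>F. \<forall>q\<in>F. \<exists>s\<in>F. (s, p) \<in> {(U, V). U \<in> P \<and> V \<in> P \<and> V \<subseteq> U} \<and>
    (s, q) \<in> {(U, V). U \<in> P \<and> V \<in> P \<and> V \<subseteq> U}"
    unfolding poset_filter_def by (elim conjE)
  from this[THEN bspec, OF UV(1), THEN bspec, OF UV(3)]
  obtain W where "W \<in> F" "U \<subseteq> W" "V \<subseteq> W"
    by auto
  then show ?case
    using UV by (intro bexI[of _ W]) auto
qed

text \<open>The union of a sufficiently generic filter of open sets of measure below
  \<open>e\<close> covers every member of \<open>\<N>\<close> and has measure at most
  \<open>e\<close>. Density: a condition \<open>U\<close> can absorb a null set by means of an open
  cover of measure below its slack \<open>e - prob U\<close>.\<close>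

lemma null_sets_small_Union:
  assumes MA: "martins_axiom TYPE(real)" and small: "\<N> \<prec> (UNIV :: real set)"
    and null: "\<And>N. N \<in> \<N> \<Longrightarrow> N \<in> null_sets (completion M)"
  shows "\<Union>\<N> \<in> null_sets (completion M)"
proof (rule null_if_small_covers)
  fix e :: real assume e: "0 < e"
  define P where "P = {U. openin T U \<and> prob U < e}"
  let ?r = "{(U, V). U \<in> P \<and> V \<in> P \<and> V \<subseteq> U}"
  define D where "D N = {U\<in>P. N \<subseteq> U}" for N
  have dense: "dense_in_poset P ?r (D N)" if N: "N \<in> \<N>" for N
    unfolding dense_in_poset_def
  proof (intro conjI ballI)
    show "D N \<subseteq> P"
      by (auto simp: D_def)
    fix U assume U: "U \<in> P"
    then obtain V where V: "openin T V" "N \<subseteq> V" "prob V < e - prob U"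
      using open_cover_null[OF null[OF N], of "e - prob U"] by (auto simp: P_def)
    have "prob (U \<union> V) \<le> prob U + prob V"
      using U V by (intro measure_Un_le) (auto simp: P_def intro: open_event)
    then have "U \<union> V \<in> P"
      using U V by (auto simp: P_def)
    then show "\<exists>d\<in>D N. (d, U) \<in> ?r"
      using U V by (intro bexI[of _ "U \<union> V"]) (auto simp: D_def)
  qed
  have "P \<noteq> {}"
    using e by (auto simp: P_def intro!: exI[of _ "{}"])
  moreover have "ccc_poset P ?r"
    unfolding P_def by (rule ccc_amoeba)
  moreover have "\<forall>X\<in>D ` \<N>. dense_in_poset P ?r X"
    using dense by simp
  moreover have "D ` \<N> \<prec> (UNIV :: real set)"
    using small image_lepoll lesspoll_trans1 by blast
  \<comment> \<open>The conditions are sets of points, so the axiom for posets of reals is first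
    carried over to the type of such sets.\<close>
  ultimately have "\<exists>F. poset_filter P ?r F \<and> (\<forall>X\<in>D ` \<N>. F \<inter> X \<noteq> {})"
    by (intro martins_axiom_any_type[OF MA, where 'p = "'x set", unfolded martins_axiom_def, rule_format] conjI)
  then obtain F where F: "poset_filter P ?r F" "\<forall>X\<in>D ` \<N>. F \<inter> X \<noteq> {}"
    by (elim exE conjE)
  have FP: "F \<subseteq> P"
    using F by (simp add: poset_filter_def)
  \<comment> \<open>The filter may be uncountable. Its union is rewritten as a union of countably
    many basic sets, any finitely many of which lie in a single condition of the filter.\<close>
  define S where "S = {B\<in>\<B>. \<exists>U\<in>F. B \<subseteq> U}"
  have US: "\<Union>F = \<Union>S"
  proof
    show "\<Union>F \<subseteq> \<Union>S"
    proof
      fix x assume "x \<in> \<Union>F"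
      then obtain U where U: "U \<in> F" "x \<in> U"
        by blast
      then have "openin T U"
        using FP by (auto simp: P_def)
      then obtain B where "B \<in> \<B>" "x \<in> B" "B \<subseteq> U"
        using base(3) U(2) by meson
      then show "x \<in> \<Union>S"
        using U(1) by (auto simp: S_def)
    qed
  qed (auto simp: S_def)
  have "prob (\<Union>F) \<le> e"
  proof (rule ccontr)
    assume *: "\<not> prob (\<Union>F) \<le> e"
    have S: "countable S" "S \<subseteq> events" "0 < prob (\<Union>F) - e"
      using base(1,2) open_event * by (auto simp: S_def)
    obtain Y where Y: "finite Y" "Y \<subseteq> S" "prob (\<Union>S) - (prob (\<Union>F) - e) < prob (\<Union>Y)"
      by (rule finite_subfamily_approx[OF S])
    then have "\<forall>B\<in>Y. \<exists>U\<in>F. B \<subseteq> U"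
      by (auto simp: S_def)
    then obtain U where U: "U \<in> F" "\<Union>Y \<subseteq> U"
      using filter_finite_subcover[OF F(1) Y(1)] by blast
    then have "openin T U" "prob U < e"
      using FP by (auto simp: P_def)
    then have "prob (\<Union>Y) < e"
      using finite_measure_mono[OF U(2) open_event] by (meson le_less_trans)
    then show False
      using Y(3) US by simp
  qed
  moreover have "openin T (\<Union>F)"
    using FP by (auto simp: P_def)
  moreover have "\<Union>\<N> \<subseteq> \<Union>F"
    using F(2) by (fastforce simp: D_def)
  ultimately show "\<exists>U. openin T U \<and> \<Union>\<N> \<subseteq> U \<and> prob U \<le> e"
    by blast
qed

text \<open>Under MA, index sets below the continuum behave like countable ones. The exceptional
  sets need not be Borel, so the argument takes place in the completion, where the same statements
  hold almost everywhere.\<close>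

lemma AE_small_ball:
  assumes "martins_axiom TYPE(real)" "I \<prec> (UNIV :: real set)" "\<And>i. i \<in> I \<Longrightarrow> AE x in M. Q i x"
  shows "AE x in M. \<forall>i\<in>I. Q i x"
proof -
  define N where "N i = {x\<in>space M. \<not> Q i x}" for i
  have "N i \<in> null_sets (completion M)" if "i \<in> I" for i
    using AE_completion[OF assms(3)[OF that]] completion.AE_iff_null_sets[of "Q i" M]
    by (simp add: N_def)
  moreover have "N ` I \<prec> (UNIV :: real set)"
    using assms(2) image_lepoll lesspoll_trans1 by blast
  ultimately have "\<Union>(N ` I) \<in> null_sets (completion M)"
    by (intro null_sets_small_Union[OF assms(1)]) auto
  also have "\<Union>(N ` I) = {x\<in>space M. \<not> (\<forall>i\<in>I. Q i x)}"
    by (auto simp: N_def)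
  finally have "AE x in completion M. \<forall>i\<in>I. Q i x"
    unfolding completion.AE_iff_null_sets space_completion .
  then show ?thesis
    by (simp only: AE_completion_iff)
qed

section \<open>Cardinality of the space and of a null set\<close>

lemma points_eqI:
  assumes "x \<in> space M" "y \<in> space M" "\<forall>B\<in>\<B>. x \<in> B \<longleftrightarrow> y \<in> B"
  shows "x = y"
proof (rule ccontr)
  assume "x \<noteq> y"
  then obtain U where "openin T U" "x \<in> U" "y \<notin> U"
    using metrizable_imp_t1_space[OF metrizable] assms(1,2) unfolding t1_space_def topspace by meson
  then show False
    using base(3) assms(3) by blast
qed

text \<open>A point is coded by the set of basic open sets that contain it, a subset of a countable
  set.\<close>

lemma space_lepoll_real: "space M \<lesssim> (UNIV :: real set)"
proof -
  have "inj_on (\<lambda>x. {B\<in>\<B>. x \<in> B}) (space M)"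
    by (intro inj_onI points_eqI) auto
  then have "space M \<lesssim> Pow \<B>"
    unfolding lepoll_def by (intro exI[of _ "\<lambda>x. {B\<in>\<B>. x \<in> B}"]) auto
  then show ?thesis
    using Pow_countable_lepoll_real[OF base(1)] lepoll_trans by blast
qed

text \<open>A null \<open>G\<^sub>\<delta>\<close> set containing a countable dense subset of the support is, inside the
  support, a perfect completely metrizable space.\<close>

lemma null_set_of_size_continuum:
  assumes "\<And>x. x \<in> space M \<Longrightarrow> prob {x} = 0"
  obtains N where "N \<in> null_sets M" "(UNIV :: real set) \<lesssim> N"
proof -
  \<comment> \<open>\<open>Z\<close> is the largest open null set and \<open>X\<close> is the
    support of the measure.\<close>
  define Z where "Z = \<Union>{B\<in>\<B>. prob B = 0}"
  define X where "X = space M - Z"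
  have Zop: "openin T Z"
    unfolding Z_def using base(2) by auto
  have Z: "Z \<in> null_sets M"
    unfolding Z_def using base(1,2) open_event
    by (intro null_sets_UN'[where N = "\<lambda>B. B" and I = "{B\<in>\<B>. prob B = 0}", simplified])
       (auto simp: null_sets_def emeasure_eq_measure)
  have meet: "\<exists>B\<in>\<B>. B \<inter> X \<noteq> {} \<and> B \<subseteq> U" if U: "openin T U" "prob U \<noteq> 0" for U
  proof -
    have "\<not> U \<subseteq> Z"
      using U Z null_sets_subset[of Z M U] open_event[of U] measure_eq_0_null_sets[of U M] by blast
    then obtain x where "x \<in> U" "x \<in> X"
      using openin_subset[OF U(1)] by (auto simp: X_def)
    then show ?thesis
      using base(3)[OF U(1)] by blast
  qed
  have pos: "prob U \<noteq> 0" if U: "openin T U" "x \<in> U" "x \<in> X" for U x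
  proof
    assume 0: "prob U = 0"
    obtain B where B: "B \<in> \<B>" "x \<in> B" "B \<subseteq> U"
      using base(3) U by blast
    then have "prob B \<le> prob U"
      using U open_event by (intro finite_measure_mono) auto
    then have "prob B = 0"
      using 0 by (simp add: measure_le_0_iff)
    then show False
      using B U by (auto simp: X_def Z_def)
  qed
  \<comment> \<open>One point of the support is taken from every basic set that meets it. The
    resulting countable set is null because points are.\<close>
  define D where "D = (\<lambda>B. SOME x. x \<in> B \<inter> X) ` {B\<in>\<B>. B \<inter> X \<noteq> {}}"
  have D: "(SOME x. x \<in> B \<inter> X) \<in> B \<inter> X" if "B \<inter> X \<noteq> {}" for B
    using that some_in_eq[of "B \<inter> X"] by blast
  have DX: "D \<subseteq> X"
    using D by (auto simp: D_def)
  have "countable D"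
    using base(1) by (auto simp: D_def)
  then have "(\<Union>x\<in>D. {x}) \<in> null_sets M"
    using assms point_event DX
    by (intro null_sets_UN') (auto simp: null_sets_def emeasure_eq_measure X_def)
  then have "D \<in> null_sets (completion M)"
    by (simp add: null_sets_completionI)
  then have "\<exists>U. openin T U \<and> D \<subseteq> U \<and> prob U < inverse (Suc n)" for n :: nat
    by (rule open_cover_null[of D "inverse (Suc n)"]) auto
  then obtain U where U: "\<And>n. openin T (U n)" "\<And>n. D \<subseteq> U n" "\<And>n::nat. prob (U n) < inverse (Suc n)"
    by metis
  define S where "S = (\<Inter>n. U n) \<inter> X"
  have DS: "D \<subseteq> S"
    using U DX by (auto simp: S_def)
  have "closedin T X"
    unfolding X_def using Zop by (metis closedin_diff closedin_topspace topspace)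
  then have "gdelta_in T X"
    using metrizable closed_imp_gdelta_in by blast
  moreover have "gdelta_in T (\<Inter>n. U n)"
    using U(1) by (intro gdelta_in_Inter) (auto intro: open_imp_gdelta_in)
  ultimately have "gdelta_in T S"
    unfolding S_def by (intro gdelta_in_Int)
  then have cm: "completely_metrizable_space (subtopology T S)"
    using complete completely_metrizable_space_gdelta_in by blast
  have SX: "S \<subseteq> space M"
    by (auto simp: S_def X_def)
  \<comment> \<open>No point \<open>x\<close> of \<open>S\<close> is isolated: an open
    \<open>V\<close> around \<open>x\<close> has positive measure, and still has it without
    \<open>x\<close>. Hence \<open>V - {x}\<close> contains a basic set that meets the support, and
    with it a point of \<open>D \<subseteq> S\<close>.\<close>
  have "S \<subseteq> subtopology T S derived_set_of S"
  proof
    fix x assume x: "x \<in> S"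
    have "\<exists>y. y \<noteq> x \<and> y \<in> S \<and> y \<in> W" if "x \<in> W" "openin (subtopology T S) W" for W
    proof -
      obtain V where V: "openin T V" "W = V \<inter> S"
        using \<open>openin (subtopology T S) W\<close> by (auto simp: openin_subtopology)
      have "closedin T {x}"
        using metrizable_imp_t1_space[OF metrizable] x SX by (auto simp: t1_space_closedin_singleton)
      then have o: "openin T (V - {x})"
        using V by blast
      have "prob (V - {x}) = prob V - prob {x}"
        using V x SX \<open>x \<in> W\<close> point_event open_event by (intro finite_measure_Diff) auto
      moreover have "prob V \<noteq> 0"
        using pos[OF V(1)] x V \<open>x \<in> W\<close> by (auto simp: S_def)
      ultimately have "prob (V - {x}) \<noteq> 0"
        using assms x SX by auto
      then obtain B where B: "B \<in> \<B>" "B \<inter> X \<noteq> {}" "B \<subseteq> V - {x}"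
        using meet o by blast
      then have "(SOME x. x \<in> B \<inter> X) \<in> D"
        by (auto simp: D_def)
      then show ?thesis
        using D[OF B(2)] B(3) DS V by blast
    qed
    then show "x \<in> subtopology T S derived_set_of S"
      using x SX by (auto simp: in_derived_set_of)
  qed
  moreover have "subtopology T S derived_set_of S \<subseteq> S"
    using derived_set_of_subset_topspace[of "subtopology T S" S] by auto
  moreover have "S \<noteq> {}"
  proof -
    have "prob (space M) \<noteq> 0"
      by (simp add: prob_space)
    then show ?thesis
      using meet[of "space M"] DS openin_topspace[of T] by (auto simp: D_def)
  qed
  ultimately have "(UNIV :: real set) \<lesssim> S"
    using lepoll_perfect_set[of "subtopology T S" S] cm by blast
  moreover have "S \<in> null_sets M"
  proof -
    have "S \<in> null_sets (completion M)"
    proof (rule null_if_small_covers)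
      fix e :: real assume "0 < e"
      then obtain n where "inverse (Suc n) < e"
        using reals_Archimedean by blast
      then show "\<exists>U. openin T U \<and> S \<subseteq> U \<and> prob U \<le> e"
        using U(1) U(3)[of n] by (intro exI[of _ "U n"]) (auto simp: S_def)
    qed
    moreover have "S \<in> events"
      unfolding S_def X_def using U(1) Zop open_event by (intro sets.Int sets.countable_INT') auto
    ultimately show ?thesis
      by (simp add: null_sets_completion_iff)
  qed
  ultimately show ?thesis
    using that by blast
qed

end

lemma non_atomic_point:
  assumes "non_atomic M" "{x} \<in> sets M"
  shows "measure M {x} = 0"
proof (rule ccontr)
  assume "measure M {x} \<noteq> 0"
  then have "emeasure M {x} > 0"
    by (metis measure_eq_emeasure_eq_ennreal ennreal_0 order_refl zero_less_iff_neq_zero)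
  then obtain B where "B \<subseteq> {x}" "0 < emeasure M B" "emeasure M B < emeasure M {x}"
    using assms by (auto simp: non_atomic_def)
  then show False
    by (auto simp: subset_singleton_iff)
qed

lemma standard_borel_imp_polish_prob_space:
  assumes "prob_space M" "standard_borel M"
  obtains T \<B> where "polish_prob_space M T \<B>"
proof -
  obtain T where T: "polish_topology T" "topspace T = space M"
    "sets M = sigma_sets (space M) {U. openin T U}"
    using assms(2) by (auto simp: standard_borel_def)
  then have "second_countable T"
    using separable_metrizable_imp_second_countable completely_metrizable_imp_metrizable_space
    by (auto simp: polish_topology_def)
  then obtain \<B> where "countable \<B>" "\<forall>V\<in>\<B>. openin T V"
    "\<forall>U x. openin T U \<and> x \<in> U \<longrightarrow> (\<exists>V\<in>\<B>. x \<in> V \<and> V \<subseteq> U)"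
    by (auto simp: second_countable_def)
  then have "polish_prob_space M T \<B>"
    using assms(1) T
    by (auto simp: polish_prob_space_def polish_prob_space_axioms_def polish_topology_def)
  then show ?thesis
    by (rule that)
qed

section \<open>Completing partial group actions\<close>

lemma lesspoll_iff_ordLess: "A \<prec> B \<longleftrightarrow> ordLess2 (card_of A) (card_of B)"
proof -
  have "ordLess2 (card_of A) (card_of B) \<longleftrightarrow> \<not> B \<lesssim> A"
    unfolding card_of_ordLess[symmetric] lepoll_def ..
  moreover have "ordLess2 (card_of A) (card_of B) \<Longrightarrow> A \<lesssim> B"
    by (meson card_of_ordLeq lepoll_def ordLess_imp_ordLeq)
  ultimately show ?thesis
    unfolding lesspoll_def by (meson eqpoll_imp_lepoll eqpoll_sym lepoll_antisym)
qed

lemma lepoll_iff_ordLeq: "A \<lesssim> B \<longleftrightarrow> ordLeq3 (card_of A) (card_of B)"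
  by (simp add: lepoll_def card_of_ordLeq)

lemma Times_lepoll_real:
  assumes "A \<lesssim> (UNIV :: real set)" "B \<lesssim> (UNIV :: real set)"
  shows "A \<times> B \<lesssim> (UNIV :: real set)"
  using assms infinite_UNIV_char_0[where 'a = real] card_of_Card_order unfolding lepoll_iff_ordLeq
  by (intro card_of_Times_ordLeq_infinite_Field) (simp_all only: Field_card_of not_False_eq_True)

lemma (in group) generate_lesspoll_real:
  assumes A: "A \<subseteq> carrier G" "A \<prec> (UNIV :: real set)"
  shows "generate G A \<prec> (UNIV :: real set)"
proof -
  \<comment> \<open>Adding a copy of the naturals makes the bounding cardinal infinite even for
    finite \<open>A\<close>, and keeps it below the continuum because the reals are
    uncountable.\<close>
  let ?C = "A <+> (UNIV :: nat set)"
  let ?r = "card_of ?C"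
  define S where "S = rec_nat (insert \<one> A) (\<lambda>_ B. B \<union> (\<lambda>(x, y). x \<otimes> y) ` (B \<times> B) \<union> m_inv G ` B)"
  have S0: "S 0 = insert \<one> A"
    and SS: "S (Suc n) = S n \<union> (\<lambda>(x, y). x \<otimes> y) ` (S n \<times> S n) \<union> m_inv G ` S n" for n
    by (simp_all add: S_def)
  have inf: "\<not> finite ?C"
    by simp
  then have co: "\<not> finite (Field ?r)" "Card_order ?r"
    using card_of_Card_order by (simp_all only: Field_card_of not_False_eq_True)
  have n: "ordLeq3 (card_of (S n)) ?r" for n
  proof (induction n)
    case 0
    have "ordLeq3 (card_of ({\<one>} \<union> A)) ?r"
      by (intro card_of_Un_ordLeq_infinite_Field co card_of_Plus1 card_of_singl_ordLeq) auto
    then show ?case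
      by (simp add: S0)
  next
    case (Suc n)
    have "ordLeq3 (card_of (S n \<times> S n)) ?r"
      using Suc co by (simp add: card_of_Times_ordLeq_infinite_Field)
    then show ?case
      unfolding SS using Suc
      by (intro card_of_Un_ordLeq_infinite_Field co Suc)
         (auto intro: ordLeq_transitive[OF card_of_image])
  qed
  have mono: "S m \<subseteq> S n" if "m \<le> n" for m n
    using that by (rule lift_Suc_mono_le[rotated]) (auto simp: SS)
  have "x \<in> (\<Union>n. S n)" if "x \<in> generate G A" for x
    using that
  proof (induction rule: generate.induct)
    case one
    then show ?case
      using S0 by blast
  next
    case (incl h)
    then show ?case
      using S0 by blast
  next
    case (inv h)
    then have "inv h \<in> S (Suc 0)"
      by (auto simp: SS S0)
    then show ?case
      by blast
  next
    case (eng h1 h2)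
    then obtain m k where "h1 \<in> S m" "h2 \<in> S k"
      by auto
    then have "h1 \<in> S (max m k)" "h2 \<in> S (max m k)"
      using mono by (meson max.cobounded1 max.cobounded2 subsetD)+
    then have "h1 \<otimes> h2 \<in> S (Suc (max m k))"
      by (auto simp: SS)
    then show ?case
      by blast
  qed
  then have "ordLeq3 (card_of (generate G A)) (card_of (\<Union>n. S n))"
    by (intro card_of_mono1) auto
  also have "ordLeq3 (card_of (\<Union>n. S n)) ?r"
    using n by (intro card_of_UNION_ordLeq_infinite inf card_of_Plus2) auto
  also have "ordLess2 ?r (card_of (UNIV :: real set))"
  proof (rule card_of_Plus_ordLess_infinite)
    show "ordLess2 (card_of (UNIV :: nat set)) (card_of (UNIV :: real set))"
      using uncountable_UNIV_real unfolding card_of_ordLess[symmetric] countable_def by auto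
  qed (use A infinite_UNIV_char_0 lesspoll_iff_ordLess in auto)
  finally show ?thesis
    by (simp add: lesspoll_iff_ordLess)
qed

text \<open>\<open>card_of\<close> is a well-order of least length, so each initial segment
  \<open>under r a\<close> has fewer than continuum many elements. The segments are nested, hence so
  are the subgroups that they generate.\<close>

lemma (in group) small_subgroup_chain:
  assumes "carrier G \<lesssim> (UNIV :: real set)"
  obtains \<C> where "\<And>H. H \<in> \<C> \<Longrightarrow> subgroup H G" "\<And>H. H \<in> \<C> \<Longrightarrow> H \<prec> (UNIV :: real set)"
    "\<And>H K. H \<in> \<C> \<Longrightarrow> K \<in> \<C> \<Longrightarrow> H \<subseteq> K \<or> K \<subseteq> H" "\<Union>\<C> = carrier G"
proof -
  define r where "r = card_of (carrier G)"
  have r: "Card_order r" "Well_order r" "Field r = carrier G"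
    unfolding r_def by (rule card_of_Card_order card_of_Well_order Field_card_of)+
  then have lin: "trans r" "total_on (carrier G) r" "refl_on (carrier G) r"
    by (auto simp: well_order_on_def linear_order_on_def partial_order_on_def preorder_on_def)
  have sub: "under r a \<subseteq> carrier G" for a
    using r(3) by (auto simp: under_def Field_def)
  have small: "under r a \<prec> (UNIV :: real set)" if "a \<in> carrier G" for a
  proof -
    have "ordLess2 (card_of (underS r a)) r"
      using that r by (intro card_of_underS) auto
    then have "ordLess2 (card_of (underS r a)) (card_of (UNIV :: real set))"
      using assms ordLess_ordLeq_trans unfolding r_def lepoll_iff_ordLeq by blast
    moreover have "ordLess2 (card_of {a}) (card_of (UNIV :: real set))"
      unfolding lesspoll_iff_ordLess[symmetric]
      using infinite_UNIV_char_0 by (intro finite_lesspoll_infinite) auto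
    ultimately have "ordLess2 (card_of (underS r a \<union> {a})) (card_of (UNIV :: real set))"
      using infinite_UNIV_char_0 by (intro card_of_Un_ordLess_infinite) auto
    moreover have "under r a \<subseteq> underS r a \<union> {a}"
      by (auto simp: under_def underS_def)
    ultimately show ?thesis
      unfolding lesspoll_iff_ordLess using card_of_mono1 ordLeq_ordLess_trans by blast
  qed
  have chain: "generate G (under r a) \<subseteq> generate G (under r b) \<or>
    generate G (under r b) \<subseteq> generate G (under r a)" if "a \<in> carrier G" "b \<in> carrier G" for a b
  proof -
    have "(a, b) \<in> r \<or> (b, a) \<in> r"
      using lin(2,3) that by (metis refl_onD total_on_def)
    then have "under r a \<subseteq> under r b \<or> under r b \<subseteq> under r a"
      using lin(1) by (meson under_incr)
    then show ?thesis
      using mono_generate by blast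
  qed
  have "a \<in> generate G (under r a)" if "a \<in> carrier G" for a
    using that lin(3) by (intro generate.incl) (auto simp: under_def refl_on_def)
  moreover have "generate G (under r a) \<subseteq> carrier G" for a
    using generate_incl[OF sub] .
  ultimately have "\<Union>((\<lambda>a. generate G (under r a)) ` carrier G) = carrier G"
    by blast
  then show ?thesis
    using chain generate_is_subgroup[OF sub] generate_lesspoll_real[OF sub small]
    by (intro that[of "(\<lambda>a. generate G (under r a)) ` carrier G"]) auto
qed

section \<open>From partial actions to genuine actions\<close>

lemma (in group) group_actionI:
  assumes closed: "\<And>g x. g \<in> carrier G \<Longrightarrow> x \<in> X \<Longrightarrow> \<rho> g x \<in> X"
    and one: "\<And>x. x \<in> X \<Longrightarrow> \<rho> \<one> x = x"
    and mult: "\<And>g h x. g \<in> carrier G \<Longrightarrow> h \<in> carrier G \<Longrightarrow> x \<in> X \<Longrightarrow> \<rho> (g \<otimes> h) x = \<rho> g (\<rho> h x)"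
  shows "group_action G X (\<lambda>g. restrict (\<rho> g) X)"
proof -
  \<comment> \<open>Elements of \<open>BijGroup X\<close> are extensional, hence the restriction;
    the inverse of \<open>\<rho> g\<close> on \<open>X\<close> is
    \<open>\<rho> (inv g)\<close>.\<close>
  have bij: "restrict (\<rho> g) X \<in> Bij X" if g: "g \<in> carrier G" for g
  proof -
    have "bij_betw (\<rho> g) X X"
      using g closed one mult[of g "inv g"] mult[of "inv g" g]
      by (intro bij_betwI[where g = "\<rho> (inv g)"]) (auto simp flip: mult)
    then show ?thesis
      by (simp add: Bij_def bij_betw_restrict_eq)
  qed
  moreover have "restrict (\<rho> (g \<otimes> h)) X = compose X (restrict (\<rho> g) X) (restrict (\<rho> h) X)"
    if "g \<in> carrier G" "h \<in> carrier G" for g h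
    using that closed mult by (auto simp: compose_def restrict_def)
  ultimately have "(\<lambda>g. restrict (\<rho> g) X) \<in> hom G (BijGroup X)"
    by (auto simp: hom_def BijGroup_def)
  then show ?thesis
    by (simp add: group_action_def group_hom_def group_hom_axioms_def group_BijGroup group_axioms)
qed

text \<open>Places an abstract \<open>G\<close>-set inside \<open>X\<close>: its action is
  conjugated by the injection, and the points outside the image are fixed by all of
  \<open>G\<close>.\<close>

lemma (in group) group_action_transport:
  assumes act: "\<And>g w. g \<in> carrier G \<Longrightarrow> w \<in> W \<Longrightarrow> act g w \<in> W"
    "\<And>w. w \<in> W \<Longrightarrow> act \<one> w = w"
    "\<And>g h w. g \<in> carrier G \<Longrightarrow> h \<in> carrier G \<Longrightarrow> w \<in> W \<Longrightarrow> act (g \<otimes> h) w = act g (act h w)"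
    and inj: "inj_on \<psi> W" "\<psi> ` W \<subseteq> X"
  obtains \<rho> where "group_action G X \<rho>" "\<And>g w. g \<in> carrier G \<Longrightarrow> w \<in> W \<Longrightarrow> \<rho> g (\<psi> w) = \<psi> (act g w)"
proof -
  define \<rho> where "\<rho> g x = (if x \<in> \<psi> ` W then \<psi> (act g (inv_into W \<psi> x)) else x)" for g x
  have \<rho>: "\<rho> g (\<psi> w) = \<psi> (act g w)" if "w \<in> W" for g w
    using that inj by (simp add: \<rho>_def)
  have id: "\<rho> g x = x" if "x \<notin> \<psi> ` W" for g x
    using that by (simp add: \<rho>_def)
  show ?thesis
  proof (rule that[of "\<lambda>g. restrict (\<rho> g) X"])
    show "group_action G X (\<lambda>g. restrict (\<rho> g) X)"
    proof (rule group_actionI)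
      fix g x assume gx: "g \<in> carrier G" "x \<in> X"
      show "\<rho> g x \<in> X"
      proof (cases "x \<in> \<psi> ` W")
        case True
        then obtain w where "w \<in> W" "x = \<psi> w" by blast
        then show ?thesis
          using gx act(1) inj(2) by (auto simp: \<rho>)
      qed (use gx id in auto)
    next
      fix x
      show "\<rho> \<one> x = x"
        using \<rho> id act(2) by (cases "x \<in> \<psi> ` W") auto
    next
      fix g h x assume gh: "g \<in> carrier G" "h \<in> carrier G"
      show "\<rho> (g \<otimes> h) x = \<rho> g (\<rho> h x)"
      proof (cases "x \<in> \<psi> ` W")
        case True
        then obtain w where "w \<in> W" "x = \<psi> w" by blast
        then show ?thesis
          using gh act(1,3) by (simp add: \<rho>)
      qed (simp add: id)
    qed
    show "restrict (\<rho> g) X (\<psi> w) = \<psi> (act g w)" if "g \<in> carrier G" "w \<in> W" for g w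
      using that \<rho> inj(2) by (auto simp: restrict_def)
  qed
qed

text \<open>This is what it means for \<open>H\<close> to act genuinely at \<open>x\<close>. The
  orbit has to avoid \<open>N\<close> because \<open>N\<close> is set aside for the new points of
  the induced \<open>G\<close>-sets.\<close>

definition acts_at :: "('g, 'b) monoid_scheme \<Rightarrow> ('g \<Rightarrow> 'x \<Rightarrow> 'x) \<Rightarrow> 'x set \<Rightarrow> 'g set \<Rightarrow> 'x \<Rightarrow> bool" where
  "acts_at G \<eta> N H x \<longleftrightarrow> \<eta> \<one>\<^bsub>G\<^esub> x = x \<and> (\<forall>g\<in>H. \<eta> g x \<notin> N) \<and>
     (\<forall>g\<in>H. \<forall>h\<in>H. \<eta> (g \<otimes>\<^bsub>G\<^esub> h) x = \<eta> g (\<eta> h x))"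

text \<open>The conditions speak of the base point only; associativity, with all products staying in
  \<open>H\<close>, carries them along the orbit.\<close>

lemma (in group) acts_at_orbit:
  assumes H: "subgroup H G" and x: "acts_at G \<eta> N H x" and k: "k \<in> H"
  shows "acts_at G \<eta> N H (\<eta> k x)"
proof -
  have HG: "g \<in> carrier G" if "g \<in> H" for g
    using that H by (rule subgroup.mem_carrier[rotated])
  have mult: "\<eta> g (\<eta> h x) = \<eta> (g \<otimes> h) x" if "g \<in> H" "h \<in> H" for g h
    using that x by (simp add: acts_at_def)
  have "\<eta> (g \<otimes> h) (\<eta> k x) = \<eta> g (\<eta> h (\<eta> k x))" if "g \<in> H" "h \<in> H" for g h
    using that k H HG by (simp add: mult subgroup.m_closed m_assoc)
  moreover have "\<eta> \<one> (\<eta> k x) = \<eta> k x"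
    using k H HG by (simp add: mult subgroup.one_closed)
  moreover have "\<eta> g (\<eta> k x) \<notin> N" if "g \<in> H" for g
  proof -
    have "g \<otimes> k \<in> H"
      using that k H by (simp add: subgroup.m_closed)
    then have "\<eta> (g \<otimes> k) x \<notin> N"
      using x unfolding acts_at_def by blast
    then show ?thesis
      using mult[OF that k] by simp
  qed
  ultimately show ?thesis
    by (simp add: acts_at_def)
qed

text \<open>The elements of the induced \<open>G\<close>-sets are represented as the classes \<open>cl g x\<close> of pairs \<open>(g, x)\<close>
  under \<open>(g k, x) \<sim> (g, k x)\<close>, for \<open>k \<in> A x\<close>.\<close>

lemma (in group) induced_action:
  fixes \<eta> :: "'a \<Rightarrow> 'x \<Rightarrow> 'x"
  assumes sg: "\<And>H. H \<in> \<C> \<Longrightarrow> subgroup H G"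
    and chain: "\<And>H K. H \<in> \<C> \<Longrightarrow> K \<in> \<C> \<Longrightarrow> H \<subseteq> K \<or> K \<subseteq> H"
    and G: "carrier G \<lesssim> (UNIV :: real set)" and X: "X \<lesssim> (UNIV :: real set)"
    and N: "N \<subseteq> X" "(UNIV :: real set) \<lesssim> N"
    and closed: "\<And>g. g \<in> carrier G \<Longrightarrow> \<eta> g \<in> X \<rightarrow> X"
  obtains \<rho> where "group_action G X \<rho>"
    "\<And>H g x. H \<in> \<C> \<Longrightarrow> g \<in> H \<Longrightarrow> x \<in> X \<Longrightarrow> acts_at G \<eta> N H x \<Longrightarrow> \<rho> g x = \<eta> g x"
proof -
  define A where "A x = \<Union>{H\<in>\<C>. acts_at G \<eta> N H x}" for x
  define D where "D = {x\<in>X. \<exists>H\<in>\<C>. acts_at G \<eta> N H x}"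
  \<comment> \<open>Of two members of the chain the larger contains both elements. Thus, for
    \<open>x\<close> in \<open>D\<close>, \<open>A x\<close> is again a subgroup, and the
    multiplication rule at \<open>x\<close> holds for all of it.\<close>
  have common: "\<exists>H\<in>\<C>. acts_at G \<eta> N H x \<and> g \<in> H \<and> h \<in> H" if gh: "g \<in> A x" "h \<in> A x" for g h x
  proof -
    obtain H K where "H \<in> \<C>" "acts_at G \<eta> N H x" "g \<in> H" "K \<in> \<C>" "acts_at G \<eta> N K x" "h \<in> K"
      using gh by (auto simp: A_def)
    then show ?thesis
      using chain[of H K] by blast
  qed
  have A_carrier: "g \<in> carrier G" if "g \<in> A x" for g x
    using that sg subgroup.mem_carrier by (fastforce simp: A_def)
  have one_A: "\<one> \<in> A x" and eta_one: "\<eta> \<one> x = x" and xN: "x \<notin> N" if "x \<in> D" for x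
  proof -
    obtain H where H: "H \<in> \<C>" "acts_at G \<eta> N H x"
      using \<open>x \<in> D\<close> by (auto simp: D_def)
    then show "\<one> \<in> A x" "\<eta> \<one> x = x"
      using sg[OF H(1)] subgroup.one_closed by (auto simp: A_def acts_at_def)
    then show "x \<notin> N"
      using H sg[OF H(1)] subgroup.one_closed by (force simp: acts_at_def)
  qed
  have mult_A: "g \<otimes> h \<in> A x" and eta_mult: "\<eta> (g \<otimes> h) x = \<eta> g (\<eta> h x)"
    and inv_A: "inv g \<in> A x" if gh: "g \<in> A x" "h \<in> A x" for g h x
  proof -
    obtain H where H: "H \<in> \<C>" "acts_at G \<eta> N H x" "g \<in> H" "h \<in> H"
      using common[OF gh] by blast
    then show "g \<otimes> h \<in> A x" "inv g \<in> A x"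
      using subgroup.m_closed[OF sg[OF H(1)]] subgroup.m_inv_closed[OF sg[OF H(1)]] by (auto simp: A_def)
    show "\<eta> (g \<otimes> h) x = \<eta> g (\<eta> h x)"
      using H by (auto simp: acts_at_def)
  qed
  have sub_A: "A x \<subseteq> A (\<eta> k x)" if k: "k \<in> A x" for k x
  proof
    fix g assume "g \<in> A x"
    then obtain H where "H \<in> \<C>" "acts_at G \<eta> N H x" "g \<in> H" "k \<in> H"
      using common k by blast
    then show "g \<in> A (\<eta> k x)"
      using acts_at_orbit[OF sg, of H \<eta> N x k] by (auto simp: A_def)
  qed
  \<comment> \<open>Moving along the orbit can only enlarge \<open>A\<close>; moving back by
    \<open>inv k\<close> gives equality.\<close>
  have A_orbit: "A (\<eta> k x) = A x" and D_orbit: "\<eta> k x \<in> D" if x: "x \<in> D" and k: "k \<in> A x" for k x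
  proof -
    have kG: "k \<in> carrier G"
      using k A_carrier by blast
    have "\<eta> (inv k) (\<eta> k x) = x"
      using eta_mult[OF inv_A[OF k k] k] kG eta_one[OF x] by simp
    moreover have "inv k \<in> A (\<eta> k x)"
      using sub_A[OF k] inv_A[OF k k] by blast
    ultimately have "A (\<eta> k x) \<subseteq> A x"
      using sub_A[of "inv k" "\<eta> k x"] by simp
    then show "A (\<eta> k x) = A x"
      using sub_A[OF k] by blast
    have "\<eta> k x \<in> X"
      using closed[OF kG] x by (auto simp: D_def)
    moreover obtain H where "H \<in> \<C>" "acts_at G \<eta> N H x" "k \<in> H"
      using common[OF k k] by blast
    then have "\<exists>H\<in>\<C>. acts_at G \<eta> N H (\<eta> k x)"
      using acts_at_orbit[OF sg, of H \<eta> N x k] by blast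
    ultimately show "\<eta> k x \<in> D"
      by (simp add: D_def)
  qed
  define cl where "cl g x = (\<lambda>k. (g \<otimes> inv k, \<eta> k x)) ` A x" for g x
  define W where "W = (\<lambda>(g, x). cl g x) ` (carrier G \<times> D)"
  define act where "act h C = (\<lambda>(g, x). (h \<otimes> g, x)) ` C" for h :: 'a and C :: "('a \<times> 'x) set"
  have act_cl: "act h (cl g x) = cl (h \<otimes> g) x" if "g \<in> carrier G" "h \<in> carrier G" for g h x
    unfolding act_def cl_def image_image
    using that A_carrier by (intro image_cong) (auto simp: m_assoc)
  have W_cases: "\<exists>g x. g \<in> carrier G \<and> x \<in> D \<and> w = cl g x" if "w \<in> W" for w
    using that by (auto simp: W_def)
  have cl_W: "cl g x \<in> W" if "g \<in> carrier G" "x \<in> D" for g x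
    using that by (auto simp: W_def)
  \<comment> \<open>The class \<open>cl \<one> x\<close> is the copy of the point \<open>x\<close>
    in the induced set, and \<open>h\<close> sends it to \<open>cl h x\<close>. By this identity
    that is the copy of \<open>\<eta> h x\<close>, so the induced action extends the partial one.
    The proof reindexes the class by \<open>k \<otimes> h\<close>.\<close>
  have move: "cl \<one> (\<eta> h x) = cl h x" if x: "x \<in> D" and h: "h \<in> A x" for h x
  proof -
    have hG: "h \<in> carrier G"
      using h A_carrier by blast
    have "cl \<one> (\<eta> h x) = (\<lambda>k. (h \<otimes> inv (k \<otimes> h), \<eta> (k \<otimes> h) x)) ` A x"
      unfolding cl_def A_orbit[OF x h]
      using hG h A_carrier eta_mult by (intro image_cong) (auto simp: inv_mult_group m_assoc[symmetric])
    also have "\<dots> = (\<lambda>k. (h \<otimes> inv k, \<eta> k x)) ` (\<lambda>k. k \<otimes> h) ` A x"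
      by (simp add: image_image)
    also have "(\<lambda>k. k \<otimes> h) ` A x = A x"
    proof
      show "A x \<subseteq> (\<lambda>k. k \<otimes> h) ` A x"
      proof
        fix k assume k: "k \<in> A x"
        then have "k = (k \<otimes> inv h) \<otimes> h"
          using hG A_carrier by (simp add: m_assoc)
        moreover have "k \<otimes> inv h \<in> A x"
          using k h mult_A inv_A by blast
        ultimately show "k \<in> (\<lambda>k. k \<otimes> h) ` A x"
          by blast
      qed
    qed (use h mult_A in auto)
    finally show ?thesis
      by (simp add: cl_def)
  qed
  have inj: "inj_on (cl \<one>) D"
  proof (rule inj_onI)
    fix x y assume xy: "x \<in> D" "y \<in> D" "cl \<one> x = cl \<one> y"
    have "(\<one> \<otimes> inv \<one>, \<eta> \<one> y) \<in> cl \<one> y"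
      unfolding cl_def using one_A[OF xy(2)] by blast
    then have "(\<one>, y) \<in> cl \<one> x"
      using eta_one[OF xy(2)] xy(3) by simp
    then obtain k where k: "k \<in> A x" "\<one> = inv k" "y = \<eta> k x"
      using A_carrier by (auto simp: cl_def)
    then have "k = \<one>"
      using A_carrier by (metis inv_inv inv_one)
    then show "x = y"
      using k eta_one[OF xy(1)] by simp
  qed
  have "carrier G \<times> D \<lesssim> (UNIV :: real set)"
    using G X by (intro Times_lepoll_real) (auto simp: D_def intro: lepoll_trans[OF subset_imp_lepoll])
  then have "W \<lesssim> (UNIV :: real set)"
    unfolding W_def using image_lepoll lepoll_trans by blast
  then have "W \<lesssim> N"
    using N(2) lepoll_trans by blast
  then obtain i where i: "inj_on i W" "i ` W \<subseteq> N"
    by (auto simp: lepoll_def)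
  \<comment> \<open>Copies of points of \<open>D\<close> return to these points and all other
    classes go into \<open>N\<close>. The two ranges are disjoint, since \<open>D\<close> avoids
    \<open>N\<close>.\<close>
  define \<psi> where "\<psi> w = (if w \<in> cl \<one> ` D then inv_into D (cl \<one>) w else i w)" for w
  have \<psi>_cl: "\<psi> (cl \<one> x) = x" if "x \<in> D" for x
    using that inj by (simp add: \<psi>_def)
  have \<psi>_D: "\<psi> w \<in> D" if "w \<in> cl \<one> ` D" for w
    using that \<psi>_cl by auto
  have \<psi>_N: "\<psi> w \<in> N" if "w \<in> W" "w \<notin> cl \<one> ` D" for w
    using that i by (auto simp: \<psi>_def)
  have \<psi>_inj: "inj_on \<psi> W"
  proof (rule inj_onI)
    fix v w assume vw: "v \<in> W" "w \<in> W" "\<psi> v = \<psi> w"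
    then consider "v \<in> cl \<one> ` D" "w \<in> cl \<one> ` D" | "v \<notin> cl \<one> ` D" "w \<notin> cl \<one> ` D"
      using \<psi>_D \<psi>_N xN by metis
    then show "v = w"
    proof cases
      case 1
      then show ?thesis
        using vw(3) \<psi>_cl by auto
    next
      case 2
      then show ?thesis
        using vw i by (simp add: \<psi>_def inj_on_def)
    qed
  qed
  have \<psi>_X: "\<psi> ` W \<subseteq> X"
  proof
    fix y assume "y \<in> \<psi> ` W"
    then obtain w where "w \<in> W" "y = \<psi> w" by blast
    then show "y \<in> X"
      using \<psi>_D[of w] \<psi>_N[of w] N(1) by (cases "w \<in> cl \<one> ` D") (auto simp: D_def)
  qed
  have act_W: "act g w \<in> W" if "g \<in> carrier G" "w \<in> W" for g w
    using W_cases[OF that(2)] that(1) act_cl cl_W by auto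
  have act_one: "act \<one> w = w" if "w \<in> W" for w
    using W_cases[OF that] act_cl by auto
  have act_mult: "act (g \<otimes> h) w = act g (act h w)" if "g \<in> carrier G" "h \<in> carrier G" "w \<in> W" for g h w
    using W_cases[OF that(3)] that(1,2) act_cl by (auto simp: m_assoc)
  have "\<exists>\<rho>. group_action G X \<rho> \<and> (\<forall>g\<in>carrier G. \<forall>w\<in>W. \<rho> g (\<psi> w) = \<psi> (act g w))"
    by (rule group_action_transport[OF act_W act_one act_mult \<psi>_inj \<psi>_X]) auto
  then obtain \<rho> where \<rho>: "group_action G X \<rho>"
    "\<And>g w. g \<in> carrier G \<Longrightarrow> w \<in> W \<Longrightarrow> \<rho> g (\<psi> w) = \<psi> (act g w)"
    by blast
  show ?thesis
  proof (rule that[OF \<rho>(1)])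
    fix H g x assume H: "H \<in> \<C>" "g \<in> H" "x \<in> X" "acts_at G \<eta> N H x"
    then have x: "x \<in> D" and g: "g \<in> A x"
      by (auto simp: D_def A_def)
    have gG: "g \<in> carrier G"
      using g A_carrier by blast
    have "\<rho> g x = \<rho> g (\<psi> (cl \<one> x))"
      using \<psi>_cl[OF x] by simp
    also have "\<dots> = \<psi> (cl g x)"
      using \<rho>(2)[OF gG cl_W[OF _ x]] gG by (simp add: act_cl)
    also have "\<dots> = \<eta> g x"
      using move[OF x g] \<psi>_cl[OF D_orbit[OF x g]] by simp
    finally show "\<rho> g x = \<eta> g x" .
  qed
qed

section \<open>Near-actions\<close>

lemma (in prob_space) image_measure_preserving_AE_cong:
  assumes f: "image_measure_preserving M f" and eq: "AE x in M. f x = r x"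
    and r: "inj_on r (space M)" "r ` space M = space M"
  shows "image_measure_preserving M r"
proof -
  obtain Z where Z: "{x\<in>space M. f x \<noteq> r x} \<subseteq> Z" "Z \<in> null_sets M"
    using eq by (auto elim!: AE_E)
  have fr: "f ` A = r ` A" if "A \<subseteq> space M - Z" for A
    using that Z(1) by (intro image_cong) auto
  define Y where "Y = f ` (space M - Z)"
  have Y: "Y \<in> sets (completion M)" "emeasure (completion M) Y = emeasure M (space M - Z)"
    using f Z(2) by (auto simp: image_measure_preserving_def Y_def)
  have "emeasure (completion M) Y = 1"
    using Y(2) Z(2) by (simp add: emeasure_Diff_null_set emeasure_space_1)
  then have "emeasure (completion M) (space (completion M) - Y) = 0"
    using Y(1) by (subst emeasure_compl) (auto simp: emeasure_space_1)
  then have Yn: "space M - Y \<in> null_sets (completion M)"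
    using Y(1) by (auto simp: null_sets_def)
  have "r ` Z \<subseteq> space M - Y"
  proof
    fix y assume "y \<in> r ` Z"
    then obtain z where z: "z \<in> Z" "y = r z"
      by blast
    then have "z \<in> space M"
      using Z(2) sets.sets_into_space by (auto simp: null_sets_def)
    moreover have "y \<notin> r ` (space M - Z)"
      using z \<open>z \<in> space M\<close> inj_onD[OF r(1)] by blast
    ultimately show "y \<in> space M - Y"
      using z r(2) fr[of "space M - Z"] by (auto simp: Y_def)
  qed
  then have rZ: "r ` (B \<inter> Z) \<in> null_sets (completion M)" for B
    using Yn by (elim null_sets_completion_subset[rotated]) auto
  show ?thesis
    unfolding image_measure_preserving_def
  proof
    fix B assume B: "B \<in> sets M"
    have "r ` B = r ` (B - Z) \<union> r ` (B \<inter> Z)"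
      by blast
    also have "r ` (B - Z) = f ` (B - Z)"
      using fr[of "B - Z"] sets.sets_into_space[OF B] by auto
    finally have rB: "r ` B = f ` (B - Z) \<union> r ` (B \<inter> Z)" .
    have "B - Z \<in> events"
      using B Z(2) by auto
    then have fB: "f ` (B - Z) \<in> sets (completion M)"
      "emeasure (completion M) (f ` (B - Z)) = emeasure M B"
      using f emeasure_Diff_null_set[OF Z(2) B] unfolding image_measure_preserving_def by metis+
    show "r ` B \<in> sets (completion M) \<and> emeasure (completion M) (r ` B) = emeasure M B"
      unfolding rB using fB rZ[of B] by (metis emeasure_Un_null_set null_setsD2 sets.Un)
  qed
qed

locale near_action = prob_space M + group G
  for M :: "'x measure" and G :: "('g, 'b) monoid_scheme" (structure) +
  fixes \<eta> :: "'g \<Rightarrow> 'x \<Rightarrow> 'x"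
  assumes near_action: "measure_preserving_near_action G M \<eta>"
begin

lemma eta_space: "g \<in> carrier G \<Longrightarrow> \<eta> g \<in> space M \<rightarrow> space M"
  and eta_one: "AE x in M. \<eta> \<one> x = x"
  and eta_mult: "g \<in> carrier G \<Longrightarrow> h \<in> carrier G \<Longrightarrow> AE x in M. \<eta> (g \<otimes> h) x = \<eta> g (\<eta> h x)"
  and eta_image: "g \<in> carrier G \<Longrightarrow> image_measure_preserving M (\<eta> g)"
  using near_action by (auto simp: measure_preserving_near_action_def)

lemma eta_inv: "g \<in> carrier G \<Longrightarrow> AE x in M. \<eta> (inv g) (\<eta> g x) = x"
  using eta_mult[of "inv g" g] eta_one by (auto elim!: eventually_elim2)

text \<open>Only forward images are controlled, but \<open>\<eta> g\<close> is inverted almost everywhere by \<open>\<eta> (inv g)\<close>, so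
  preimages under \<open>\<eta> g\<close> are, up to null sets, forward images under \<open>\<eta> (inv g)\<close>.\<close>

lemma AE_vimage_subset_image:
  assumes "g \<in> carrier G"
  shows "AE x in M. \<eta> g x \<in> B \<longrightarrow> x \<in> \<eta> (inv g) ` B"
  using eta_inv[OF assms] by eventually_elim force

lemma eta_null:
  assumes g: "g \<in> carrier G" and Z: "Z \<in> null_sets M"
  shows "AE x in M. \<eta> g x \<notin> Z"
proof -
  have "\<eta> (inv g) ` Z \<in> null_sets (completion M)"
    using eta_image[of "inv g"] g Z by (auto simp: image_measure_preserving_def null_sets_def)
  then have "AE x in M. x \<notin> \<eta> (inv g) ` Z"
    using AE_not_in AE_completion_iff by blast
  moreover have "AE x in M. \<eta> g x \<in> Z \<longrightarrow> x \<in> \<eta> (inv g) ` Z"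
    by (rule AE_vimage_subset_image[OF g])
  ultimately show ?thesis
    by eventually_elim auto
qed

text \<open>The substitution rule for near-actions: since \<open>\<eta> g\<close> almost never
  enters a given null set, \<open>\<eta> g x\<close> may replace \<open>x\<close> in statements that
  hold almost everywhere.\<close>

lemma AE_eta:
  assumes g: "g \<in> carrier G" and P: "AE x in M. P x"
  shows "AE x in M. P (\<eta> g x)"
proof -
  obtain Z where Z: "{x\<in>space M. \<not> P x} \<subseteq> Z" "Z \<in> null_sets M"
    using P by (auto elim!: AE_E)
  show ?thesis
    using eta_null[OF g Z(2)] AE_space by eventually_elim (use Z(1) eta_space[OF g] in auto)
qed

lemma eta_vimage:
  assumes g: "g \<in> carrier G" and B: "B \<in> events"
  shows "\<exists>Q\<in>events. AE x in M. \<eta> g x \<in> B \<longleftrightarrow> x \<in> Q"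
proof -
  have im: "\<eta> (inv g) ` B \<in> sets (completion M)"
    using eta_image[of "inv g"] g B by (auto simp: image_measure_preserving_def)
  have "AE y in M. \<eta> g (\<eta> (inv g) y) = y"
    using eta_inv[of "inv g"] g by simp
  then obtain Z where Z: "{y\<in>space M. \<eta> g (\<eta> (inv g) y) \<noteq> y} \<subseteq> Z" "Z \<in> null_sets M"
    by (auto elim!: AE_E)
  \<comment> \<open>For the converse inclusion: if \<open>y\<close> in \<open>B\<close> lies outside
    \<open>Z\<close>, then \<open>\<eta> g\<close> takes \<open>\<eta> (inv g) y\<close> back to
    \<open>y\<close>. The images of the remaining points form a null set.\<close>
  have "\<eta> (inv g) ` Z \<in> null_sets (completion M)"
    using eta_image[of "inv g"] g Z by (auto simp: image_measure_preserving_def null_sets_def)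
  then have "AE x in M. x \<notin> \<eta> (inv g) ` Z"
    using AE_not_in AE_completion_iff by blast
  then have "AE x in M. \<eta> g x \<in> B \<longleftrightarrow> x \<in> main_part M (\<eta> (inv g) ` B)"
    using AE_vimage_subset_image[OF g, of B] AE_in_main_part[OF im]
  proof eventually_elim
    case (elim x)
    have "\<eta> g x \<in> B" if x: "x \<in> \<eta> (inv g) ` B"
    proof -
      obtain y where y: "y \<in> B" "x = \<eta> (inv g) y"
        using x by blast
      then have "y \<notin> Z" "y \<in> space M"
        using elim(1) sets.sets_into_space[OF B] by auto
      then show ?thesis
        using Z(1) y by auto
    qed
    then show ?case
      using elim by blast
  qed
  then show ?thesis
    using im by blast
qed

section \<open>The quotient by the elements acting trivially almost everywhere\<close>

definition ae_kernel :: "'g set" where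
  "ae_kernel = {g \<in> carrier G. AE x in M. \<eta> g x = x}"

lemma ae_kernel_normal: "ae_kernel \<lhd> G"
  unfolding normal_inv_iff
proof (intro conjI ballI)
  show "subgroup ae_kernel G"
  proof
    show "ae_kernel \<subseteq> carrier G"
      by (auto simp: ae_kernel_def)
    show "\<one> \<in> ae_kernel"
      using eta_one by (simp add: ae_kernel_def)
    show "g \<otimes> h \<in> ae_kernel" if gh: "g \<in> ae_kernel" "h \<in> ae_kernel" for g h
    proof -
      have "g \<in> carrier G" "h \<in> carrier G" and ae: "AE x in M. \<eta> g x = x" "AE x in M. \<eta> h x = x"
        using gh by (auto simp: ae_kernel_def)
      moreover from this have "AE x in M. \<eta> (g \<otimes> h) x = x"
        using eta_mult[of g h] ae by (auto elim!: eventually_elim2)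
      ultimately show ?thesis
        by (simp add: ae_kernel_def)
    qed
    show "inv g \<in> ae_kernel" if "g \<in> ae_kernel" for g
    proof -
      have g: "g \<in> carrier G" and "AE x in M. \<eta> g x = x"
        using that by (auto simp: ae_kernel_def)
      then have "AE x in M. \<eta> (inv g) x = x"
        using eta_inv[OF g] by (auto elim!: eventually_elim2)
      then show ?thesis
        using g by (simp add: ae_kernel_def)
    qed
  qed
  fix g h assume g: "g \<in> carrier G" and "h \<in> ae_kernel"
  then have h: "h \<in> carrier G" "AE x in M. \<eta> h x = x"
    by (auto simp: ae_kernel_def)
  have "AE x in M. \<eta> (g \<otimes> h) x = \<eta> g x"
    using eta_mult[OF g h(1)] h(2) by eventually_elim simp
  then have "AE x in M. \<eta> (g \<otimes> h) (\<eta> (inv g) x) = \<eta> g (\<eta> (inv g) x)"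
    using g by (intro AE_eta) auto
  moreover have "AE x in M. \<eta> (g \<otimes> h \<otimes> inv g) x = \<eta> (g \<otimes> h) (\<eta> (inv g) x)"
    using g h by (intro eta_mult) auto
  moreover have "AE x in M. \<eta> g (\<eta> (inv g) x) = x"
    using eta_inv[of "inv g"] g by simp
  ultimately have "AE x in M. \<eta> (g \<otimes> h \<otimes> inv g) x = x"
    by eventually_elim simp
  then show "g \<otimes> h \<otimes> inv g \<in> ae_kernel"
    using g h by (simp add: ae_kernel_def)
qed

lemma ae_kernel_subgroup: "subgroup ae_kernel G"
  using ae_kernel_normal normal_imp_subgroup by blast

lemma AE_eq_if_same_coset:
  assumes h: "h \<in> carrier G" and g: "g \<in> ae_kernel #> h"
  shows "AE x in M. \<eta> g x = \<eta> h x"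
proof -
  obtain k where k: "k \<in> carrier G" "AE x in M. \<eta> k x = x" "g = k \<otimes> h"
    using g by (auto simp: r_coset_def ae_kernel_def)
  show ?thesis
    using eta_mult[OF k(1) h] AE_eta[OF h k(2)] unfolding k(3) by eventually_elim simp
qed

text \<open>Substituting \<open>\<eta> (inv h) x\<close> shows that \<open>g \<otimes> inv h\<close>
  is trivial almost everywhere. With \<open>AE_eq_if_same_coset\<close>, cosets of the kernel are
  the same as classes of almost everywhere equal maps.\<close>

lemma same_coset_if_AE_eq:
  assumes g: "g \<in> carrier G" and h: "h \<in> carrier G" and eq: "AE x in M. \<eta> g x = \<eta> h x"
  shows "ae_kernel #> g = ae_kernel #> h"
proof -
  have "AE x in M. \<eta> (g \<otimes> inv h) x = \<eta> g (\<eta> (inv h) x)"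
    using g h by (intro eta_mult) auto
  moreover have "AE x in M. \<eta> g (\<eta> (inv h) x) = \<eta> h (\<eta> (inv h) x)"
    using h eq by (intro AE_eta) auto
  moreover have "AE x in M. \<eta> h (\<eta> (inv h) x) = x"
    using eta_inv[of "inv h"] h by simp
  ultimately have "AE x in M. \<eta> (g \<otimes> inv h) x = x"
    by eventually_elim simp
  then have "g \<otimes> inv h \<in> ae_kernel"
    using g h by (simp add: ae_kernel_def)
  then have "(g \<otimes> inv h) \<otimes> h \<in> ae_kernel #> h"
    by (auto simp: r_coset_def)
  then have "g \<in> ae_kernel #> h"
    using g h by (simp add: m_assoc)
  then show ?thesis
    using repr_independence[OF _ h ae_kernel_subgroup] by simp
qed

definition coset_rep :: "'g set \<Rightarrow> 'g" where
  "coset_rep C = (SOME g. g \<in> C)"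

lemma coset_rep_in: "C \<in> rcosets ae_kernel \<Longrightarrow> coset_rep C \<in> C"
  using ae_kernel_subgroup subgroup.rcosets_non_empty by (auto simp: coset_rep_def some_in_eq)

lemma coset_rep_carrier: "C \<in> rcosets ae_kernel \<Longrightarrow> coset_rep C \<in> carrier G"
  using coset_rep_in rcosets_part_G[OF ae_kernel_subgroup] by blast

lemma coset_of_rep: "C \<in> rcosets ae_kernel \<Longrightarrow> ae_kernel #> coset_rep C = C"
proof -
  assume C: "C \<in> rcosets ae_kernel"
  then obtain g where "g \<in> carrier G" "C = ae_kernel #> g"
    by (auto simp: RCOSETS_def)
  then show ?thesis
    using repr_independence[OF _ _ ae_kernel_subgroup, of "coset_rep C" g] coset_rep_in[OF C] by simp
qed

lemma AE_coset_rep: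
  assumes "g \<in> carrier G"
  shows "AE x in M. \<eta> g x = \<eta> (coset_rep (ae_kernel #> g)) x"
proof -
  have C: "ae_kernel #> g \<in> rcosets ae_kernel"
    using assms ae_kernel_subgroup by (auto simp: RCOSETS_def)
  show ?thesis
    using AE_eq_if_same_coset[OF assms coset_rep_in[OF C]] by (simp add: eq_commute)
qed

text \<open>The representatives need not form a homomorphic section. A near-action tolerates this,
  because the product of two representatives and the representative of the product act alike almost
  everywhere.\<close>

lemma near_action_Mod: "measure_preserving_near_action (G Mod ae_kernel) M (\<lambda>C. \<eta> (coset_rep C))"
  unfolding measure_preserving_near_action_def
proof (intro conjI ballI)
  show "AE x in M. \<eta> (coset_rep \<one>\<^bsub>G Mod ae_kernel\<^esub>) x = x"
  proof -
    have "ae_kernel \<in> rcosets ae_kernel"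
      using ae_kernel_normal normal.factorgroup_is_group group.is_monoid monoid.one_closed
      by (metis (no_types, lifting) FactGroup_def monoid.select_convs(2) partial_object.select_convs(1))
    then have "coset_rep ae_kernel \<in> ae_kernel"
      by (rule coset_rep_in)
    then show ?thesis
      by (simp add: ae_kernel_def FactGroup_def)
  qed
  fix C assume "C \<in> carrier (G Mod ae_kernel)"
  then have C: "C \<in> rcosets ae_kernel"
    by (simp add: FactGroup_def)
  show "\<eta> (coset_rep C) \<in> space M \<rightarrow> space M" "image_measure_preserving M (\<eta> (coset_rep C))"
    using coset_rep_carrier[OF C] eta_space eta_image by auto
  fix D assume "D \<in> carrier (G Mod ae_kernel)"
  then have D: "D \<in> rcosets ae_kernel"
    by (simp add: FactGroup_def)
  have "C \<otimes>\<^bsub>G Mod ae_kernel\<^esub> D = ae_kernel #> (coset_rep C \<otimes> coset_rep D)"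
    using normal.rcos_sum[OF ae_kernel_normal coset_rep_carrier[OF C] coset_rep_carrier[OF D]] coset_of_rep C D
    by (simp add: FactGroup_def)
  then show "AE x in M. \<eta> (coset_rep (C \<otimes>\<^bsub>G Mod ae_kernel\<^esub> D)) x = \<eta> (coset_rep C) (\<eta> (coset_rep D) x)"
    using AE_coset_rep[of "coset_rep C \<otimes> coset_rep D"] eta_mult[OF coset_rep_carrier[OF C] coset_rep_carrier[OF D]]
      coset_rep_carrier[OF C] coset_rep_carrier[OF D]
    by (auto elim!: eventually_elim2)
qed

text \<open>The action of the quotient is composed with the projection, and changing representatives
  alters \<open>\<eta> g\<close> on a null set only.\<close>

lemma spatial_model_from_Mod:
  assumes "spatial_model (G Mod ae_kernel) M (\<lambda>C. \<eta> (coset_rep C)) \<rho>"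
  shows "spatial_model G M \<eta> (\<lambda>g. \<rho> (ae_kernel #> g))"
proof -
  have C: "ae_kernel #> g \<in> carrier (G Mod ae_kernel)" if "g \<in> carrier G" for g
    using that by (auto simp: FactGroup_def RCOSETS_def)
  have "\<rho> \<in> hom (G Mod ae_kernel) (BijGroup (space M))"
    using assms by (simp add: spatial_model_def group_action_def group_hom_def group_hom_axioms_def)
  then have "(\<lambda>g. \<rho> (ae_kernel #> g)) \<in> hom G (BijGroup (space M))"
    using normal.r_coset_hom_Mod[OF ae_kernel_normal] C by (auto simp: hom_def)
  then have "group_action G (space M) (\<lambda>g. \<rho> (ae_kernel #> g))"
    by (simp add: group_action_def group_hom_def group_hom_axioms_def group_BijGroup group_axioms)
  moreover have "AE x in M. \<eta> g x = \<rho> (ae_kernel #> g) x" if g: "g \<in> carrier G" for g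
  proof -
    have "AE x in M. \<eta> (coset_rep (ae_kernel #> g)) x = \<rho> (ae_kernel #> g) x"
      using assms C[OF g] by (simp add: spatial_model_def)
    with AE_coset_rep[OF g] show ?thesis
      by eventually_elim simp
  qed
  ultimately show ?thesis
    using assms C by (simp add: spatial_model_def)
qed

end

section \<open>Counting the quotient, and assembly of the spatial model\<close>

locale polish_near_action = polish_prob_space M T \<B> + near_action M G \<eta>
  for M :: "'x measure" and T \<B> and G :: "('g, 'b) monoid_scheme" (structure) and \<eta>

text \<open>Outer regularity with errors \<open>1 / (n + 1)\<close>. Up to null sets this codes an
  event by a sequence of open sets, and there are at most continuum many such sequences.\<close>

lemma (in polish_prob_space) gdelta_hull:
  assumes Q: "Q \<in> events"
  shows "\<exists>U. (\<forall>n::nat. openin T (U n)) \<and> (AE x in M. x \<in> Q \<longleftrightarrow> (\<forall>n. x \<in> U n))"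
proof -
  have "\<exists>U. openin T U \<and> Q \<subseteq> U \<and> prob U < prob Q + inverse (Suc n)" for n :: nat
    by (rule outer_regular[OF Q, of "inverse (Suc n)"]) auto
  then obtain U where U: "\<And>n. openin T (U n)" "\<And>n. Q \<subseteq> U n"
    "\<And>n::nat. prob (U n) < prob Q + inverse (Suc n)"
    by metis
  have I: "(\<Inter>n. U n) \<in> events"
    using U(1) open_event by (intro sets.countable_INT) auto
  have "prob (\<Inter>n. U n) \<le> prob Q + e" if e: "0 < e" for e
  proof -
    obtain n where "inverse (Suc n) < e"
      using reals_Archimedean[OF e] by blast
    moreover have "prob (\<Inter>n. U n) \<le> prob (U n)"
      using U(1) by (intro finite_measure_mono) (auto intro: open_event)
    ultimately show ?thesis
      using U(3)[of n] by simp
  qed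
  then have "prob (\<Inter>n. U n) \<le> prob Q"
    by (rule field_le_epsilon)
  moreover have "prob ((\<Inter>n. U n) - Q) = prob (\<Inter>n. U n) - prob Q"
    using I Q U(2) by (intro finite_measure_Diff) auto
  ultimately have "prob ((\<Inter>n. U n) - Q) = 0"
    using measure_nonneg[of M "(\<Inter>n. U n) - Q"] by linarith
  then have "(\<Inter>n. U n) - Q \<in> null_sets M"
    using I Q by (auto simp: null_sets_def emeasure_eq_measure)
  then have "AE x in M. x \<notin> (\<Inter>n. U n) - Q"
    by (rule AE_not_in)
  then have "AE x in M. x \<in> Q \<longleftrightarrow> (\<forall>n. x \<in> U n)"
    by eventually_elim (use U(2) in blast)
  then show ?thesis
    using U(1) by blast
qed

context polish_near_action
begin

text \<open>Up to null sets, \<open>\<eta> g\<close> is determined by the preimages of the basic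
  open sets, because these separate points. Each preimage is replaced by a
  \<open>G\<^sub>\<delta>\<close> set that agrees with it almost everywhere.\<close>

lemma Mod_lepoll_real: "carrier (G Mod ae_kernel) \<lesssim> (UNIV :: real set)"
proof -
  have ex: "\<exists>U. (\<forall>n::nat. openin T (U n)) \<and> (AE x in M. \<eta> g x \<in> B \<longleftrightarrow> (\<forall>n. x \<in> U n))"
    if g: "g \<in> carrier G" and B: "B \<in> \<B>" for g B
  proof -
    obtain Q where Q: "Q \<in> events" "AE x in M. \<eta> g x \<in> B \<longleftrightarrow> x \<in> Q"
      using eta_vimage[OF g open_event[OF base(2)[OF B]]] by blast
    obtain U where U: "\<forall>n::nat. openin T (U n)" "AE x in M. x \<in> Q \<longleftrightarrow> (\<forall>n. x \<in> U n)"
      using gdelta_hull[OF Q(1)] by blast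
    have "AE x in M. \<eta> g x \<in> B \<longleftrightarrow> (\<forall>n. x \<in> U n)"
      using Q(2) U(2) by eventually_elim blast
    with U(1) show ?thesis
      by blast
  qed
  define U where "U g B = (SOME U. (\<forall>n::nat. openin T (U n)) \<and>
    (AE x in M. \<eta> g x \<in> B \<longleftrightarrow> (\<forall>n. x \<in> U n)))" for g B
  have U: "openin T (U g B n)" "AE x in M. \<eta> g x \<in> B \<longleftrightarrow> (\<forall>n. x \<in> U g B n)"
    if "g \<in> carrier G" "B \<in> \<B>" for g B n
    using someI_ex[OF ex[OF that]] by (simp_all add: U_def)
  \<comment> \<open>An open set is determined by the basic sets inside it, so the whole family
    \<open>U g\<close> is recorded, for indices in the base, by a subset of a countable set.\<close>
  define code where "code g = {(B, n, C). B \<in> \<B> \<and> C \<in> \<B> \<and> C \<subseteq> U g B n}" for g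
  have code: "AE x in M. \<eta> g x = \<eta> h x"
    if g: "g \<in> carrier G" and h: "h \<in> carrier G" and eq: "code g = code h" for g h
  proof -
    have "U g B n = U h B n" if B: "B \<in> \<B>" for B n
    proof -
      have "{C\<in>\<B>. C \<subseteq> U g B n} = {C. (B, n, C) \<in> code g}" "{C\<in>\<B>. C \<subseteq> U h B n} = {C. (B, n, C) \<in> code h}"
        using B by (auto simp: code_def)
      then show ?thesis
        using open_eq_Union_base[OF U(1)[OF g B]] open_eq_Union_base[OF U(1)[OF h B]] eq by metis
    qed
    then have "AE x in M. \<eta> g x \<in> B \<longleftrightarrow> \<eta> h x \<in> B" if B: "B \<in> \<B>" for B
      using U(2)[OF g B] U(2)[OF h B] B by (auto elim!: eventually_elim2)
    then have "AE x in M. \<forall>B\<in>\<B>. \<eta> g x \<in> B \<longleftrightarrow> \<eta> h x \<in> B"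
      using base(1) by (simp add: AE_ball_countable)
    then show ?thesis
      using AE_space
    proof eventually_elim
      case (elim x)
      show ?case
        using points_eqI[of "\<eta> g x" "\<eta> h x"] elim eta_space[OF g] eta_space[OF h] by blast
    qed
  qed
  have "inj_on (\<lambda>C. code (coset_rep C)) (rcosets ae_kernel)"
  proof (rule inj_onI)
    fix C D assume CD: "C \<in> rcosets ae_kernel" "D \<in> rcosets ae_kernel" "code (coset_rep C) = code (coset_rep D)"
    then have "AE x in M. \<eta> (coset_rep C) x = \<eta> (coset_rep D) x"
      by (intro code coset_rep_carrier)
    then have "ae_kernel #> coset_rep C = ae_kernel #> coset_rep D"
      using CD by (intro same_coset_if_AE_eq coset_rep_carrier)
    then show "C = D"
      using CD coset_of_rep by simp
  qed
  moreover have "code g \<subseteq> \<B> \<times> UNIV \<times> \<B>" for g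
    by (auto simp: code_def)
  ultimately have "rcosets ae_kernel \<lesssim> Pow (\<B> \<times> (UNIV :: nat set) \<times> \<B>)"
    unfolding lepoll_def by (intro exI[of _ "\<lambda>C. code (coset_rep C)"]) auto
  also have "\<dots> \<lesssim> (UNIV :: real set)"
    using base(1) by (intro Pow_countable_lepoll_real) auto
  finally show ?thesis
    by (simp add: FactGroup_def)
qed

lemma spatial_model_of_small_group:
  assumes MA: "martins_axiom TYPE(real)" and na: "non_atomic M" and G: "carrier G \<lesssim> (UNIV :: real set)"
  shows "\<exists>\<rho>. spatial_model G M \<eta> \<rho>"
proof -
  obtain N where N: "N \<in> null_sets M" "(UNIV :: real set) \<lesssim> N"
    using null_set_of_size_continuum[OF non_atomic_point[OF na point_event]] by blast
  have NX: "N \<subseteq> space M"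
    using N(1) sets.sets_into_space by (auto simp: null_sets_def)
  obtain \<C> where sg: "\<And>H. H \<in> \<C> \<Longrightarrow> subgroup H G" and small: "\<And>H. H \<in> \<C> \<Longrightarrow> H \<prec> (UNIV :: real set)"
    and chain: "\<And>H H'. H \<in> \<C> \<Longrightarrow> H' \<in> \<C> \<Longrightarrow> H \<subseteq> H' \<or> H' \<subseteq> H" and cover: "\<Union>\<C> = carrier G"
    using small_subgroup_chain[OF G] by blast
  have "\<exists>\<rho>. group_action G (space M) \<rho> \<and>
    (\<forall>H\<in>\<C>. \<forall>g\<in>H. \<forall>x\<in>space M. acts_at G \<eta> N H x \<longrightarrow> \<rho> g x = \<eta> g x)"
    by (rule induced_action[OF sg chain G space_lepoll_real NX N(2) eta_space]) auto
  then obtain \<rho> where \<rho>: "group_action G (space M) \<rho>"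
    "\<And>H g x. H \<in> \<C> \<Longrightarrow> g \<in> H \<Longrightarrow> x \<in> space M \<Longrightarrow> acts_at G \<eta> N H x \<Longrightarrow> \<rho> g x = \<eta> g x"
    by blast
  have acts: "AE x in M. acts_at G \<eta> N H x" if H: "H \<in> \<C>" for H
  proof -
    have HG: "g \<in> carrier G" if "g \<in> H" for g
      using that H cover by blast
    have "AE x in M. \<forall>g\<in>H. \<eta> g x \<notin> N"
      using eta_null[OF HG N(1)] by (intro AE_small_ball[OF MA small[OF H]])
    \<comment> \<open>\<open>AE_small_ball\<close> is applied once for each of the two
      quantifiers.\<close>
    moreover have "AE x in M. \<forall>g\<in>H. \<forall>h\<in>H. \<eta> (g \<otimes> h) x = \<eta> g (\<eta> h x)"
      using eta_mult[OF HG HG] by (intro AE_small_ball[OF MA small[OF H]])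
    ultimately show ?thesis
      using eta_one unfolding acts_at_def by eventually_elim blast
  qed
  have eq: "AE x in M. \<eta> g x = \<rho> g x" if g: "g \<in> carrier G" for g
  proof -
    obtain H where H: "H \<in> \<C>" "g \<in> H"
      using g cover by blast
    show ?thesis
      using acts[OF H(1)] AE_space by eventually_elim (use \<rho>(2)[OF H] in auto)
  qed
  have "image_measure_preserving M (\<rho> g)" if g: "g \<in> carrier G" for g
    using eta_image[OF g] eq[OF g] group_action.inj_prop[OF \<rho>(1) g] group_action.surj_prop[OF \<rho>(1) g]
    by (rule image_measure_preserving_AE_cong)
  then show ?thesis
    using \<rho>(1) eq by (auto simp: spatial_model_def)
qed

end

theorem theorem1p5:
  fixes M :: "'x measure" and G :: "('g, 'b) monoid_scheme"
  assumes "martins_axiom TYPE(real)"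
    and "prob_space M" and "standard_borel M" and "non_atomic M"
    and "group G"
  shows "\<forall>\<eta>. measure_preserving_near_action G M \<eta> \<longrightarrow> (\<exists>\<rho>. spatial_model G M \<eta> \<rho>)"
proof (intro allI impI)
  fix \<eta> assume \<eta>: "measure_preserving_near_action G M \<eta>"
  obtain T \<B> where "polish_prob_space M T \<B>"
    using standard_borel_imp_polish_prob_space[OF assms(2,3)] by blast
  then interpret polish_near_action M T \<B> G \<eta>
    using assms(2,5) \<eta> by (simp add: polish_near_action_def near_action_def near_action_axioms_def)
  \<comment> \<open>The quotient is itself a near-action on the same space, now of a group with at
    most continuum many elements.\<close>
  interpret Q: polish_near_action M T \<B> "G Mod ae_kernel" "\<lambda>C. \<eta> (coset_rep C)"
    using polish_prob_space_axioms prob_space_axioms normal.factorgroup_is_group[OF ae_kernel_normal] near_action_Mod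
    by (simp add: polish_near_action_def near_action_def near_action_axioms_def)
  obtain \<rho> where "spatial_model (G Mod ae_kernel) M (\<lambda>C. \<eta> (coset_rep C)) \<rho>"
    using Q.spatial_model_of_small_group[OF assms(1,4) Mod_lepoll_real] by blast
  then show "\<exists>\<rho>. spatial_model G M \<eta> \<rho>"
    using spatial_model_from_Mod by blast
qed

end
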